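(* Let $\mathbf{X}=(X(t),\,t\in\mathbb{R})$ be a stationary process with upper semi-continuous sample paths, satisfying Assumption TailSM and Assumption A. Then the density $f_{\mathbf{X},T}$ of the supremum location satisfies $$\lim_{T\to\infty}\ \sup_{\varepsilon\le t\le 1-\varepsilon}\bigl|T f_{\mathbf{X},T}(tT)-1\bigr|=0$$ for every $0<\varepsilon<1/2$. In particular, the law of $\tau_{\mathbf{X},T}/T$ converges weakly, as $T\to\infty$, to the uniform distribution on $(0,1)$.
   Context: A process $\mathbf{X}=(X(t),\,t\in\mathbb{R})$ is real-valued, defined on a probability space $(\Omega,\mathcal{F},P)$, and stationary if its finite-dimensional distributions are invariant under time shifts. For $T>0$, $\tau_{\mathbf{X},T}=\min\{t\in[0,T]: X(t)=\sup_{0\le s\le T}X(s)\}$ is the leftmost location of the supremum over $[0,T]$ (a well-defined random variable; uniqueness of the supremum location is not assumed). It is known that, for every $T>0$, the law of $\tau_{\mathbf{X},T}$ is absolutely continuous in the interior $(0,T)$ of $[0,T]$ (it may have atoms at $0$ and $T$), and that its density on $(0,T)$ has a version which is right continuous with left limits; $f_{\mathbf{X},T}$ denotes this version. Assumption TailSM: there is a function $\varphi:(0,\infty)\to\mathbb{R}$ such that $$\lim_{t\to\infty}P\Bigl(\sup_{0\le s\le t}X(s)\ge\varphi(t)\Bigr)=1$$ and $$\sup\Bigl\{\bigl|P(A\cap B)-P(A)P(B)\bigr|:\ A\in\sigma\bigl(X(s)\mathbf{1}(X(s)\ge\varphi(t)),\,s\le 0\bigr),\ B\in\sigma\bigl(X(s)\mathbf{1}(X(s)\ge\varphi(t)),\,s\ge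 t\bigr)\Bigr\}\to 0$$ as $t\to\infty$. Assumption A: $$\lim_{T\to\infty}\ \sup_{x\in\mathbb{R}}P\Bigl(\sup_{t\in[0,T]}X(t)=x\Bigr)=0.$$
   Formalization: The process is also assumed separable in Doob's sense (sample paths determined by a countable set of times); without this the claim fails, e.g. for X=V on U+Z and 0 elsewhere with U, V independent uniform on (0,1). *)

theory Defs
  imports "HOL-Probability.Probability"
begin

definition stationary :: "'a measure \<Rightarrow> (real \<Rightarrow> 'a \<Rightarrow> real) \<Rightarrow> bool" where
  "stationary M X \<longleftrightarrow>
     (\<forall>J c. finite J \<longrightarrow>
        distr M (\<Pi>\<^sub>M i\<in>J. borel) (\<lambda>\<omega>. \<lambda>i\<in>J. X (i + c) \<omega>) =
        distr M (\<Pi>\<^sub>M i\<in>J. borel) (\<lambda>\<omega>. \<lambda>i\<in>J. X i \<omega>))"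

definition upper_semicontinuous :: "(real \<Rightarrow> real) \<Rightarrow> bool" where
  "upper_semicontinuous g \<longleftrightarrow> (\<forall>t c. g t < c \<longrightarrow> (\<forall>\<^sub>F s in at t. g s < c))"

(* Separability in the sense of Doob: for one countable set D, every point of the graph
   of a sample path is a limit of points of the graph over D.  This is the standing convention
   under which functionals such as suprema over intervals are random variables whose laws are
   determined by the finite-dimensional distributions.  Doob's exceptional null set has been
   removed from the sample space.  Upper semicontinuous paths need not be separable: for U, V
   independent and uniform on (0,1), the process equal to V on the translates of U by integers and
   to 0 elsewhere has trivial finite-dimensional distributions, but its supremum over [0,1] is V. *)
definition separable_process :: "'a measure \<Rightarrow> (real \<Rightarrow> 'a \<Rightarrow> real) \<Rightarrow> bool" where
  "separable_process M X \<longleftrightarrow>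
     (\<exists>D. countable D \<and>
        (\<forall>\<omega>\<in>space M. \<forall>t. \<exists>s :: nat \<Rightarrow> real.
           range s \<subseteq> D \<and> s \<longlonglongrightarrow> t \<and> (\<lambda>n. X (s n) \<omega>) \<longlonglongrightarrow> X t \<omega>))"

definition path_sup :: "(real \<Rightarrow> 'a \<Rightarrow> real) \<Rightarrow> real \<Rightarrow> 'a \<Rightarrow> real" where
  "path_sup X T \<omega> = (SUP s\<in>{0..T}. X s \<omega>)"

definition sup_loc :: "(real \<Rightarrow> 'a \<Rightarrow> real) \<Rightarrow> real \<Rightarrow> 'a \<Rightarrow> real" where
  "sup_loc X T \<omega> = (LEAST t. t \<in> {0..T} \<and> X t \<omega> = path_sup X T \<omega>)"

(* f is the right continuous version with left limits, on the open interval (0,T), of the density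
   of the law of the supremum location; atoms of that law at 0 and T are not excluded, and the
   values of f outside (0,T) are irrelevant. *)
definition sup_loc_density :: "'a measure \<Rightarrow> (real \<Rightarrow> 'a \<Rightarrow> real) \<Rightarrow> real \<Rightarrow> (real \<Rightarrow> real) \<Rightarrow> bool" where
  "sup_loc_density M X T f \<longleftrightarrow>
     f \<in> borel_measurable (restrict_space borel {0<..<T}) \<and>
     (\<forall>t\<in>{0<..<T}. 0 \<le> f t) \<and>
     restrict_space (distr M borel (sup_loc X T)) {0<..<T} =
       density (restrict_space lborel {0<..<T}) (\<lambda>t. ennreal (f t)) \<and>
     (\<forall>t\<in>{0<..<T}. continuous (at_right t) f \<and> (\<exists>l. (f \<longlongrightarrow> l) (at_left t)))"

definition truncated :: "(real \<Rightarrow> 'a \<Rightarrow> real) \<Rightarrow> real \<Rightarrow> real \<Rightarrow> 'a \<Rightarrow> real" where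
  "truncated X u s \<omega> = X s \<omega> * indicator {u..} (X s \<omega>)"

definition generated_events :: "'a measure \<Rightarrow> (real \<Rightarrow> 'a \<Rightarrow> real) \<Rightarrow> real set \<Rightarrow> 'a set set" where
  "generated_events M Z S =
     sigma_sets (space M) {Z s -` B \<inter> space M | s B. s \<in> S \<and> B \<in> sets borel}"

definition TailSM :: "'a measure \<Rightarrow> (real \<Rightarrow> 'a \<Rightarrow> real) \<Rightarrow> bool" where
  "TailSM M X \<longleftrightarrow>
     (\<exists>\<phi> :: real \<Rightarrow> real.
        ((\<lambda>t. measure M {\<omega> \<in> space M. path_sup X t \<omega> \<ge> \<phi> t}) \<longlongrightarrow> 1) at_top \<and>
        ((\<lambda>t. SUP (A, B) \<in> generated_events M (truncated X (\<phi> t)) {..0} \<times>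
                            generated_events M (truncated X (\<phi> t)) {t..}.
                \<bar>measure M (A \<inter> B) - measure M A * measure M B\<bar>) \<longlongrightarrow> 0) at_top)"

definition assumption_A :: "'a measure \<Rightarrow> (real \<Rightarrow> 'a \<Rightarrow> real) \<Rightarrow> bool" where
  "assumption_A M X \<longleftrightarrow>
     ((\<lambda>T. SUP x. measure M {\<omega> \<in> space M. path_sup X T \<omega> = x}) \<longlongrightarrow> 0) at_top"

end

theory Submission
  imports Defs
begin

text \<open>The leftmost maximum over a long interval, if it falls into a shorter interval, is also the
  leftmost maximum over the latter.  By stationarity the density of the location over \<open>[0, T]\<close> at
  \<open>t\<close> is therefore at most its average, for the horizon \<open>(1 - \<eta>) T\<close>, over \<open>(t - \<eta> T, t]\<close>, and at
  least its average, for the horizon \<open>(1 + \<eta>) T\<close>, over \<open>(t, t + \<eta> T]\<close>.  Hence uniform convergence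
  of the densities follows from weak convergence to the uniform law.

  For the latter, cut \<open>[0, T]\<close> into \<open>n\<close> equal long blocks separated by short gaps.  The comparison
  above bounds the probability that the location lies in a gap.  The block maxima are identically
  distributed and, by TailSM, nearly independent; since by Assumption A they have only small atoms,
  each of them is the strict maximum with probability close to \<open>1 / n\<close>.\<close>

section \<open>Measurability and stationarity of suprema\<close>

text \<open>The obstacle sits in the truncation of TailSM: a discarded value is recorded as
  \<open>0\<close>, so if \<open>\<phi> t \<le> 0\<close> a recorded \<open>0\<close> is ambiguous
  and the truncated process need not determine the block suprema. A zero-one law leaves two cases.
  Either the process almost surely becomes positive at some time, and the level may be raised to
  \<open>max (\<phi> t) 0\<close>; or it is almost surely never positive, Assumption A then excludes
  the value \<open>0\<close> too, and a recorded \<open>0\<close> can only stand for a discarded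
  value.

  The gap length \<open>h\<close> doubles as the time parameter of TailSM, and blocks have length
  \<open>m h\<close>. One gap carries mass at most \<open>1 / m\<close> and all of them at most
  \<open>n / m\<close>, whatever the horizon; so \<open>n\<close> and \<open>m\<close> are fixed
  first and only \<open>h\<close> tends to infinity.

  Separability enters through countable sets that already determine the suprema. They carry
  stationarity over from finite-dimensional distributions to joint laws of suprema.\<close>

definition interval_sup :: "(real \<Rightarrow> 'a \<Rightarrow> real) \<Rightarrow> real \<Rightarrow> real \<Rightarrow> 'a \<Rightarrow> real" where
  "interval_sup X a b \<omega> = (SUP s\<in>{a..b}. X s \<omega>)"

lemma path_sup_eq: "path_sup X T = interval_sup X 0 T"
  by (simp add: fun_eq_iff path_sup_def interval_sup_def)

lemma upper_semicontinuous_open_less: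
  assumes "upper_semicontinuous g"
  shows "open {t. g t < c}"
proof -
  have "\<forall>\<^sub>F s in nhds t. g s < c" if t: "g t < c" for t
  proof -
    have "\<forall>\<^sub>F s in nhds t. s \<noteq> t \<longrightarrow> s \<in> UNIV \<longrightarrow> g s < c"
      using assms t unfolding upper_semicontinuous_def eventually_at_filter by blast
    then show ?thesis by eventually_elim (use t in auto)
  qed
  then have "\<forall>t\<in>{t. g t < c}. \<exists>T. open T \<and> t \<in> T \<and> (\<forall>s\<in>T. g s < c)"
    unfolding eventually_nhds by simp
  then show ?thesis by (subst open_subopen) (simp add: subset_eq)
qed

text \<open>If no point of \<open>K\<close> were a maximiser, the open sets
  \<open>{t. g t < g s}\<close> with \<open>s\<close> in \<open>K\<close> would cover
  \<open>K\<close>. In a finite subcover, the centre with the largest value is covered by no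
  member.\<close>

lemma upper_semicontinuous_attains_sup:
  assumes usc: "upper_semicontinuous g" and K: "compact K" "K \<noteq> {}"
  shows "\<exists>t\<in>K. \<forall>s\<in>K. g s \<le> g t"
proof (rule ccontr)
  assume "\<not> ?thesis"
  then have *: "\<forall>t\<in>K. \<exists>s\<in>K. g t < g s" by (auto simp: not_le)
  have "K \<subseteq> (\<Union>s\<in>K. {t. g t < g s})" using * by auto
  then obtain C where C: "C \<subseteq> K" "finite C" "K \<subseteq> (\<Union>s\<in>C. {t. g t < g s})"
    by (rule compactE_image[OF K(1) upper_semicontinuous_open_less[OF usc]])
  have "C \<noteq> {}" using C K by auto
  then have "Max (g ` C) \<in> g ` C" using C(2) by (intro Max_in) auto
  then obtain s where s: "s \<in> C" "Max (g ` C) = g s" by (rule imageE)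
  obtain c where "c \<in> C" "g s < g c" using C s(1) by blast
  then show False using Max_ge[of "g ` C" "g c"] C(2) s(2) by auto
qed

locale usc_process = prob_space M for M :: "'a measure" +
  fixes X :: "real \<Rightarrow> 'a \<Rightarrow> real"
  assumes X_measurable [measurable]: "X t \<in> borel_measurable M"
    and X_stationary: "stationary M X"
    and X_usc: "\<omega> \<in> space M \<Longrightarrow> upper_semicontinuous (\<lambda>t. X t \<omega>)"
    and X_separable: "separable_process M X"
begin

abbreviation "S \<equiv> interval_sup X"

lemma S_attained:
  assumes "\<omega> \<in> space M" "a \<le> b"
  obtains t where "t \<in> {a..b}" "S a b \<omega> = X t \<omega>" "\<And>s. s \<in> {a..b} \<Longrightarrow> X s \<omega> \<le> X t \<omega>"
proof -
  obtain t where t: "t \<in> {a..b}" "\<forall>s\<in>{a..b}. X s \<omega> \<le> X t \<omega>"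
    using upper_semicontinuous_attains_sup[OF X_usc[OF assms(1)], of "{a..b}"] assms(2) by auto
  moreover have "S a b \<omega> = X t \<omega>"
    unfolding interval_sup_def using t by (intro cSup_eq_maximum) auto
  ultimately show ?thesis using that by blast
qed

lemma S_upper: "\<omega> \<in> space M \<Longrightarrow> s \<in> {a..b} \<Longrightarrow> X s \<omega> \<le> S a b \<omega>"
  by (metis S_attained atLeastAtMost_iff order_trans)

lemma S_mono: "\<omega> \<in> space M \<Longrightarrow> c \<le> a \<Longrightarrow> a \<le> b \<Longrightarrow> b \<le> d \<Longrightarrow> S a b \<omega> \<le> S c d \<omega>"
  by (rule S_attained[of \<omega> a b]) (auto intro!: S_upper)

lemma S_less_iff: "\<omega> \<in> space M \<Longrightarrow> a \<le> b \<Longrightarrow> S a b \<omega> < u \<longleftrightarrow> (\<forall>s\<in>{a..b}. X s \<omega> < u)"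
  by (metis S_attained S_upper order_le_less_trans)

text \<open>A countable set that serves all paths at once. Strict inequalities express that it
  yields the supremum without requiring that the supremum be attained on it.\<close>

definition skeleton :: "real \<Rightarrow> real \<Rightarrow> real set \<Rightarrow> bool" where
  "skeleton a b E \<longleftrightarrow> countable E \<and> E \<subseteq> {a..b} \<and>
     (\<forall>\<omega>\<in>space M. \<forall>u. u < S a b \<omega> \<longrightarrow> (\<exists>e\<in>E. u < X e \<omega>))"

lemma skeleton_iff:
  "skeleton a b E \<Longrightarrow> \<omega> \<in> space M \<Longrightarrow> u < S a b \<omega> \<longleftrightarrow> (\<exists>e\<in>E. u < X e \<omega>)"
  unfolding skeleton_def by (meson S_upper order_less_le_trans subsetD)

lemma skeleton_superset:
  "skeleton a b E \<Longrightarrow> E \<subseteq> E' \<Longrightarrow> countable E' \<Longrightarrow> E' \<subseteq> {a..b} \<Longrightarrow> skeleton a b E'"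
  unfolding skeleton_def by blast

lemma skeleton_exists:
  assumes "a \<le> b"
  obtains E where "skeleton a b E"
proof -
  obtain D where D: "countable D" and
    dense: "\<And>\<omega> t. \<omega> \<in> space M \<Longrightarrow> \<exists>s :: nat \<Rightarrow> real. range s \<subseteq> D \<and> s \<longlonglongrightarrow> t \<and> (\<lambda>n. X (s n) \<omega>) \<longlonglongrightarrow> X t \<omega>"
    using X_separable unfolding separable_process_def by blast
  \<comment> \<open>A sequence in \<open>D\<close> approaching an endpoint may stay outside the
    interval, so the endpoints are added by hand; at an interior point the sequence is eventually
    inside.\<close>
  define E where "E = D \<inter> {a..b} \<union> {a, b}"
  have "\<exists>e\<in>E. u < X e \<omega>" if \<omega>: "\<omega> \<in> space M" and u: "u < S a b \<omega>" for \<omega> u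
  proof -
    obtain t where t: "t \<in> {a..b}" "S a b \<omega> = X t \<omega>" using S_attained[OF \<omega> assms] by metis
    show ?thesis
    proof (cases "t \<in> {a, b}")
      case True
      then show ?thesis using u t by (auto simp: E_def)
    next
      case False
      then have ab: "a < t" "t < b" using t by auto
      obtain s where s: "range s \<subseteq> D" "s \<longlonglongrightarrow> t" "(\<lambda>n. X (s n) \<omega>) \<longlonglongrightarrow> X t \<omega>"
        using dense[OF \<omega>] by blast
      have "\<forall>\<^sub>F n in sequentially. a < s n \<and> s n < b \<and> u < X (s n) \<omega>"
        using order_tendstoD[OF s(2)] order_tendstoD[OF s(3)] ab u t
        by (intro eventually_conj) auto
      then obtain n where "a < s n \<and> s n < b \<and> u < X (s n) \<omega>"
        using eventually_happens'[OF sequentially_bot] by blast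
      then show ?thesis using s(1) by (auto simp: E_def intro!: bexI[of _ "s n"])
    qed
  qed
  moreover have "countable E" "E \<subseteq> {a..b}" using D assms by (auto simp: E_def)
  ultimately show ?thesis using that unfolding skeleton_def by blast
qed

lemma S_measurable [measurable]:
  assumes "a \<le> b"
  shows "S a b \<in> borel_measurable M"
proof (rule borel_measurableI_greater)
  fix u
  obtain E where E: "skeleton a b E" using skeleton_exists[OF assms] .
  then have [simp]: "countable E" by (simp add: skeleton_def)
  have "{\<omega> \<in> space M. u < S a b \<omega>} = (\<Union>e\<in>E. {\<omega> \<in> space M. u < X e \<omega>})"
    using skeleton_iff[OF E] by auto
  also have "\<dots> \<in> sets M" by (intro sets.countable_UN') auto
  finally show "{\<omega> \<in> space M. u < S a b \<omega>} \<in> sets M" .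
qed

text \<open>Passing through \<open>ereal\<close> gives a formula that is measurable on the whole
  product space, where a countable family of coordinates may well be unbounded.\<close>

lemma skeleton_SUP:
  assumes E: "skeleton a b E" and \<omega>: "\<omega> \<in> space M"
  shows "S a b \<omega> = real_of_ereal (SUP e\<in>E. ereal (X e \<omega>))"
proof -
  have "(SUP e\<in>E. ereal (X e \<omega>)) = ereal (S a b \<omega>)"
  proof (rule SUP_eqI)
    fix e assume "e \<in> E"
    then show "ereal (X e \<omega>) \<le> ereal (S a b \<omega>)"
      using skeleton_iff[OF E \<omega>] by (metis ereal_less_eq(3) less_irrefl not_le)
  next
    fix y assume y: "\<And>e. e \<in> E \<Longrightarrow> ereal (X e \<omega>) \<le> y"
    show "ereal (S a b \<omega>) \<le> y"
    proof (rule ccontr)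
      assume "\<not> ereal (S a b \<omega>) \<le> y"
      then have "y < ereal (S a b \<omega>)" by simp
      then obtain u where u: "y \<le> ereal u" "u < S a b \<omega>"
        using ereal_dense2[of y "ereal (S a b \<omega>)"] by (auto dest: less_imp_le)
      then obtain e where "e \<in> E" "u < X e \<omega>" using skeleton_iff[OF E \<omega>] by blast
      then have "ereal u < y" using y[of e] by (metis ereal_less(2) ereal_less_eq(3) less_ereal.simps(1) order_less_le_trans)
      then show False using u by auto
    qed
  qed
  then show ?thesis by simp
qed

text \<open>Cylinder sets over finite index sets determine a measure on the product, so the
  finite-dimensional form of stationarity suffices.\<close>

lemma X_shift_countable:
  assumes E: "countable E"
  shows "distr M (\<Pi>\<^sub>M i\<in>E. borel) (\<lambda>\<omega>. \<lambda>i\<in>E. X (i + c) \<omega>) =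
         distr M (\<Pi>\<^sub>M i\<in>E. borel) (\<lambda>\<omega>. \<lambda>i\<in>E. X i \<omega>)" (is "?P c = ?Q")
proof (rule measure_eqI_PiM_infinite)
  show "finite_measure (?P c)" by (intro prob_space.finite_measure prob_space_distr) measurable
  fix J :: "real set" and A :: "real \<Rightarrow> real set"
  assume J: "finite J" "J \<subseteq> E" and A: "\<And>i. i \<in> J \<Longrightarrow> A i \<in> sets borel"
  have *: "emeasure (distr M (\<Pi>\<^sub>M i\<in>E. borel) (\<lambda>\<omega>. \<lambda>i\<in>E. X (i + d) \<omega>)) (prod_emb E (\<lambda>_. borel) J (Pi\<^sub>E J A))
     = emeasure (distr M (\<Pi>\<^sub>M i\<in>J. borel) (\<lambda>\<omega>. \<lambda>i\<in>J. X (i + d) \<omega>)) (Pi\<^sub>E J A)" for d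
  proof -
    have m1: "Pi\<^sub>E J A \<in> sets (\<Pi>\<^sub>M i\<in>J. borel)"
      using A J by (intro sets_PiM_I_finite) auto
    have m3: "(\<lambda>\<omega>. \<lambda>i\<in>E. X (i + d) \<omega>) \<in> measurable M (\<Pi>\<^sub>M i\<in>E. borel)"
      and m4: "(\<lambda>\<omega>. \<lambda>i\<in>J. X (i + d) \<omega>) \<in> measurable M (\<Pi>\<^sub>M i\<in>J. borel)" by measurable
    have m2: "prod_emb E (\<lambda>_. borel) J (Pi\<^sub>E J A) \<in> sets (\<Pi>\<^sub>M i\<in>E. borel)"
      using A J by (intro sets_PiM_I) auto
    have "(\<lambda>\<omega>. \<lambda>i\<in>E. X (i + d) \<omega>) -` prod_emb E (\<lambda>_. borel) J (Pi\<^sub>E J A) \<inter> space M =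
        (\<lambda>\<omega>. \<lambda>i\<in>J. X (i + d) \<omega>) -` Pi\<^sub>E J A \<inter> space M"
      using J by (auto simp: prod_emb_def PiE_iff subset_iff)
    then show ?thesis by (simp only: emeasure_distr m1 m2 m3 m4)
  qed
  show "emeasure (?P c) (prod_emb E (\<lambda>_. borel) J (Pi\<^sub>E J A)) = emeasure ?Q (prod_emb E (\<lambda>_. borel) J (Pi\<^sub>E J A))"
    using X_stationary J(1) unfolding *[of c] *[of 0, unfolded add_0_right] stationary_def by metis
qed simp_all

text \<open>Both vectors of suprema are the image, under one measurable map \<open>\<Phi>\<close>,
  of the process on a countable set \<open>U\<close>, once shifted by \<open>c\<close> and once not.
  This needs skeletons that remain skeletons after translation.\<close>

lemma S_shift:
  assumes J: "countable J" and ab: "\<And>i. i \<in> J \<Longrightarrow> a i \<le> b i"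
  shows "distr M (\<Pi>\<^sub>M i\<in>J. borel) (\<lambda>\<omega>. \<lambda>i\<in>J. S (a i + c) (b i + c) \<omega>) =
         distr M (\<Pi>\<^sub>M i\<in>J. borel) (\<lambda>\<omega>. \<lambda>i\<in>J. S (a i) (b i) \<omega>)"
proof -
  have "\<exists>E. skeleton (a i) (b i) E \<and> skeleton (a i + c) (b i + c) ((\<lambda>e. e + c) ` E)" if i: "i \<in> J" for i
  proof -
    obtain E1 where E1: "skeleton (a i) (b i) E1" using skeleton_exists ab[OF i] by blast
    obtain E2 where E2: "skeleton (a i + c) (b i + c) E2"
      using skeleton_exists[of "a i + c" "b i + c"] ab[OF i] by auto
    \<comment> \<open>Supersets of skeletons are skeletons, so joining one skeleton with the
      translate of the other works for both intervals.\<close>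
    define E where "E = E1 \<union> (\<lambda>e. e - c) ` E2"
    have "skeleton (a i) (b i) E"
      using E1 E2 by (intro skeleton_superset[OF E1]) (auto simp: E_def skeleton_def)
    moreover have "skeleton (a i + c) (b i + c) ((\<lambda>e. e + c) ` E)"
      using E1 E2 by (intro skeleton_superset[OF E2]) (force simp: E_def skeleton_def image_Un image_image)+
    ultimately show ?thesis by blast
  qed
  then obtain E where E: "\<And>i. i \<in> J \<Longrightarrow> skeleton (a i) (b i) (E i)"
    "\<And>i. i \<in> J \<Longrightarrow> skeleton (a i + c) (b i + c) ((\<lambda>e. e + c) ` E i)" by metis
  define U where "U = (\<Union>i\<in>J. E i)"
  have U: "countable U" "\<And>i. i \<in> J \<Longrightarrow> E i \<subseteq> U" "\<And>i. i \<in> J \<Longrightarrow> countable (E i)"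
    using E(1) J by (auto simp: U_def skeleton_def)
  define \<Phi> where "\<Phi> = (\<lambda>x :: real \<Rightarrow> real. \<lambda>i\<in>J. real_of_ereal (SUP e\<in>E i. ereal (x e)))"
  have \<Phi>[measurable]: "\<Phi> \<in> measurable (\<Pi>\<^sub>M i\<in>U. borel) (\<Pi>\<^sub>M i\<in>J. borel)"
    unfolding \<Phi>_def
    by (intro measurable_restrict borel_measurable_real_of_ereal borel_measurable_SUP U(3)
        borel_measurable_ereal measurable_component_singleton) (use U(2) in auto)
  have c: "distr M (\<Pi>\<^sub>M i\<in>J. borel) (\<lambda>\<omega>. \<lambda>i\<in>J. S (a i + c) (b i + c) \<omega>) =
     distr (distr M (\<Pi>\<^sub>M i\<in>U. borel) (\<lambda>\<omega>. \<lambda>i\<in>U. X (i + c) \<omega>)) (\<Pi>\<^sub>M i\<in>J. borel) \<Phi>"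
    by (subst distr_distr, measurable, intro distr_cong refl)
      (use U(2) in \<open>auto simp: \<Phi>_def fun_eq_iff skeleton_SUP[OF E(2)] image_comp subset_iff intro!: arg_cong[where f=real_of_ereal] SUP_cong\<close>)
  have z: "distr M (\<Pi>\<^sub>M i\<in>J. borel) (\<lambda>\<omega>. \<lambda>i\<in>J. S (a i) (b i) \<omega>) =
     distr (distr M (\<Pi>\<^sub>M i\<in>U. borel) (\<lambda>\<omega>. \<lambda>i\<in>U. X i \<omega>)) (\<Pi>\<^sub>M i\<in>J. borel) \<Phi>"
    by (subst distr_distr, measurable, intro distr_cong refl)
      (use U(2) in \<open>auto simp: \<Phi>_def fun_eq_iff skeleton_SUP[OF E(1)] subset_iff intro!: arg_cong[where f=real_of_ereal] SUP_cong\<close>)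
  show ?thesis unfolding c z X_shift_countable[OF U(1)] ..
qed

lemma S_shift_prob:
  assumes J: "countable J" and ab: "\<And>i. i \<in> J \<Longrightarrow> a i \<le> b i"
    and Q: "Measurable.pred (\<Pi>\<^sub>M i\<in>J. borel) Q"
  shows "prob {\<omega> \<in> space M. Q (\<lambda>i\<in>J. S (a i + c) (b i + c) \<omega>)} = prob {\<omega> \<in> space M. Q (\<lambda>i\<in>J. S (a i) (b i) \<omega>)}"
proof -
  let ?N = "\<Pi>\<^sub>M i\<in>J. (borel :: real measure)"
  have *: "prob {\<omega> \<in> space M. Q (\<lambda>i\<in>J. S (a i + d) (b i + d) \<omega>)} =
    measure (distr M ?N (\<lambda>\<omega>. \<lambda>i\<in>J. S (a i + d) (b i + d) \<omega>)) {x \<in> space ?N. Q x}" for d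
  proof -
    have "(\<lambda>\<omega>. \<lambda>i\<in>J. S (a i + d) (b i + d) \<omega>) \<in> measurable M ?N"
      by (intro measurable_restrict S_measurable) (use ab in auto)
    then show ?thesis
      using Q[THEN measurable_sets, of "{True}"]
      by (subst measure_distr) (auto simp: vimage_def Int_def conj_commute space_PiM intro!: arg_cong[where f=prob])
  qed
  show ?thesis using *[of c] *[of 0] S_shift[OF J ab] by simp
qed

section \<open>The location of the supremum and its density\<close>

text \<open>By upper semicontinuity the maximisers form a nonempty compact set. It has a least
  element, so the \<open>LEAST\<close> in \<open>sup_loc\<close> is meaningful on the reals.\<close>

lemma sup_loc_props:
  assumes \<omega>: "\<omega> \<in> space M" and T: "0 \<le> T"
  shows "sup_loc X T \<omega> \<in> {0..T}" and "X (sup_loc X T \<omega>) \<omega> = S 0 T \<omega>"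
    and "\<And>s. 0 \<le> s \<Longrightarrow> s < sup_loc X T \<omega> \<Longrightarrow> X s \<omega> < S 0 T \<omega>"
proof -
  let ?A = "{t. t \<in> {0..T} \<and> X t \<omega> = S 0 T \<omega>}"
  have "?A = {0..T} \<inter> - {t. X t \<omega> < S 0 T \<omega>}"
    using S_upper[OF \<omega>, of _ 0 T] by (auto simp: not_less intro: antisym)
  moreover have "closed (- {t. X t \<omega> < S 0 T \<omega>})"
    using upper_semicontinuous_open_less[OF X_usc[OF \<omega>]] by (simp add: closed_Compl)
  ultimately have "compact ?A" using compact_Int_closed[OF compact_Icc[of 0 T]] by simp
  moreover obtain t0 where "t0 \<in> {0..T}" "S 0 T \<omega> = X t0 \<omega>" using S_attained[OF \<omega> T] by metis
  then have "?A \<noteq> {}" by force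
  ultimately obtain t where t: "t \<in> ?A" "\<And>s. s \<in> ?A \<Longrightarrow> t \<le> s"
    using compact_attains_inf[of ?A] by blast
  have eq: "sup_loc X T \<omega> = t"
    unfolding sup_loc_def path_sup_eq using t by (intro Least_equality) auto
  show "sup_loc X T \<omega> \<in> {0..T}" "X (sup_loc X T \<omega>) \<omega> = S 0 T \<omega>" using t(1) by (auto simp: eq)
  fix s assume s: "0 \<le> s" "s < sup_loc X T \<omega>"
  then have "s \<in> {0..T}" "s \<notin> ?A" using t(1) t(2)[of s] by (auto simp: eq)
  then show "X s \<omega> < S 0 T \<omega>" using S_upper[OF \<omega>, of s 0 T] by force
qed

text \<open>Expresses events about the location through suprema alone; measurability and
  stationarity of the suprema thereby pass to the location.\<close>

lemma sup_loc_le_iff: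
  assumes \<omega>: "\<omega> \<in> space M" and T: "0 \<le> a" "a \<le> T"
  shows "sup_loc X T \<omega> \<le> a \<longleftrightarrow> S 0 T \<omega> \<le> S 0 a \<omega>"
proof
  have T0: "0 \<le> T" using T by simp
  note props = sup_loc_props[OF \<omega> T0]
  show "S 0 T \<omega> \<le> S 0 a \<omega>" if "sup_loc X T \<omega> \<le> a"
    using S_upper[OF \<omega>, of "sup_loc X T \<omega>" 0 a] props that by auto
  assume le: "S 0 T \<omega> \<le> S 0 a \<omega>"
  obtain t where t: "t \<in> {0..a}" "S 0 a \<omega> = X t \<omega>" using S_attained[OF \<omega> T(1)] by metis
  show "sup_loc X T \<omega> \<le> a"
    using props(3)[of t] t le by force
qed

lemma sup_loc_measurable [measurable]:
  assumes "0 \<le> T"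
  shows "sup_loc X T \<in> borel_measurable M"
proof (rule borel_measurableI_le)
  fix a
  have "{\<omega> \<in> space M. sup_loc X T \<omega> \<le> a} =
      (if a < 0 then {} else if T < a then space M else {\<omega> \<in> space M. S 0 T \<omega> \<le> S 0 a \<omega>})"
    using sup_loc_props(1)[OF _ assms] by (cases "a < 0"; cases "T < a") (force simp: sup_loc_le_iff not_less)+
  also have "\<dots> \<in> sets M" using S_measurable[of 0 T] S_measurable[of 0 a] assms by (auto simp: not_less)
  finally show "{\<omega> \<in> space M. sup_loc X T \<omega> \<le> a} \<in> sets M" .
qed

section \<open>Distribution function of the location: comparison of horizons\<close>

definition loc_cdf :: "real \<Rightarrow> real \<Rightarrow> real" where
  "loc_cdf T x = prob {\<omega> \<in> space M. sup_loc X T \<omega> \<le> x}"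

lemma loc_cdf_diff:
  assumes "0 \<le> T" "x \<le> y"
  shows "loc_cdf T y - loc_cdf T x = prob {\<omega> \<in> space M. x < sup_loc X T \<omega> \<and> sup_loc X T \<omega> \<le> y}"
proof -
  note [measurable] = sup_loc_measurable[OF assms(1)]
  have "prob ({\<omega> \<in> space M. sup_loc X T \<omega> \<le> y} - {\<omega> \<in> space M. sup_loc X T \<omega> \<le> x}) = loc_cdf T y - loc_cdf T x"
    unfolding loc_cdf_def using assms(2) by (intro finite_measure_Diff) auto
  moreover have "{\<omega> \<in> space M. sup_loc X T \<omega> \<le> y} - {\<omega> \<in> space M. sup_loc X T \<omega> \<le> x} =
      {\<omega> \<in> space M. x < sup_loc X T \<omega> \<and> sup_loc X T \<omega> \<le> y}" by auto
  ultimately show ?thesis by simp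
qed

lemma loc_cdf_mono: "0 \<le> T \<Longrightarrow> x \<le> y \<Longrightarrow> loc_cdf T x \<le> loc_cdf T y"
  using loc_cdf_diff[of T x y] measure_nonneg[of M] by (metis diff_ge_0_iff_ge)

lemma loc_cdf_nonneg: "0 \<le> loc_cdf T x" and loc_cdf_le_1: "loc_cdf T x \<le> 1"
  by (simp_all add: loc_cdf_def)

lemma loc_cdf_ge: "0 \<le> T \<Longrightarrow> T \<le> x \<Longrightarrow> loc_cdf T x = 1"
proof -
  assume "0 \<le> T" "T \<le> x"
  then have "{\<omega> \<in> space M. sup_loc X T \<omega> \<le> x} = space M" using sup_loc_props(1)[of _ T] by fastforce
  then show ?thesis unfolding loc_cdf_def by (simp add: prob_space)
qed

lemma loc_cdf_neg: "0 \<le> T \<Longrightarrow> x < 0 \<Longrightarrow> loc_cdf T x = 0"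
proof -
  assume "0 \<le> T" "x < 0"
  then have "{\<omega> \<in> space M. sup_loc X T \<omega> \<le> x} = {}" using sup_loc_props(1)[of _ T] by fastforce
  then show ?thesis unfolding loc_cdf_def by (simp only: measure_empty)
qed

text \<open>If the location over \<open>[0, T2]\<close> lies in \<open>(a + c, b + c]\<close>, then
  within the window \<open>[c, c + T1]\<close> the supremum is reached by time \<open>b + c\<close>
  but not by time \<open>a + c\<close>. Shifting this event by \<open>c\<close> gives exactly the
  event for the horizon \<open>T1\<close>.\<close>

lemma loc_cdf_shrink:
  assumes c: "0 \<le> c" "c + T1 \<le> T2" and ab: "0 \<le> a" "a \<le> b" "b \<le> T1"
  shows "loc_cdf T2 (b + c) - loc_cdf T2 (a + c) \<le> loc_cdf T1 b - loc_cdf T1 a"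
proof -
  have T: "0 \<le> T1" "0 \<le> T2" using assms by auto
  define l where "l = (\<lambda>i::nat. 0::real)"
  define r where "r = (\<lambda>i::nat. if i = 0 then a else if i = 1 then b else T1)"
  define J where "J = {0,1,2::nat}"
  \<comment> \<open>The three coordinates are the suprema over \<open>[0, a]\<close>,
    \<open>[0, b]\<close> and \<open>[0, T1]\<close>. For these, \<open>Q\<close> says that the
    location over \<open>[0, T1]\<close> lies in \<open>(a, b]\<close>.\<close>
  define Q where "Q = (\<lambda>x::nat \<Rightarrow> real. x 0 < x 1 \<and> x 2 \<le> x 1)"
  have comp: "(\<lambda>x. x i) \<in> borel_measurable (\<Pi>\<^sub>M i\<in>J. (borel :: real measure))" if "i \<in> J" for i
    using that by (rule measurable_component_singleton)
  have J: "0 \<in> J" "1 \<in> J" "2 \<in> J" by (auto simp: J_def)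
  have Qm: "Measurable.pred (\<Pi>\<^sub>M i\<in>J. borel) Q"
    unfolding Q_def not_less[symmetric]
    by (intro pred_intros_logic borel_measurable_pred_less comp J)
  have Qc: "Q (\<lambda>i\<in>J. S (l i + d) (r i + d) \<omega>) \<longleftrightarrow>
      S d (a + d) \<omega> < S d (b + d) \<omega> \<and> S d (T1 + d) \<omega> \<le> S d (b + d) \<omega>" for d \<omega>
    by (simp add: Q_def J_def l_def r_def)
  have sets: "{\<omega> \<in> space M. Q (\<lambda>i\<in>J. S (l i + c) (r i + c) \<omega>)} \<in> sets M"
    unfolding Qc using S_measurable[of c "a + c"] S_measurable[of c "b + c"] S_measurable[of c "T1 + c"] assms by simp
  have "loc_cdf T2 (b + c) - loc_cdf T2 (a + c) =
      prob {\<omega> \<in> space M. a + c < sup_loc X T2 \<omega> \<and> sup_loc X T2 \<omega> \<le> b + c}"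
    using T ab by (intro loc_cdf_diff) auto
  also have "\<dots> \<le> prob {\<omega> \<in> space M. Q (\<lambda>i\<in>J. S (l i + c) (r i + c) \<omega>)}"
  proof (rule finite_measure_mono[OF _ sets], clarsimp simp only: Qc mem_Collect_eq, intro conjI)
    fix \<omega> assume \<omega>: "\<omega> \<in> space M" and t: "a + c < sup_loc X T2 \<omega>" "sup_loc X T2 \<omega> \<le> b + c"
    note props = sup_loc_props[OF \<omega> T(2)]
    have ge: "S 0 T2 \<omega> \<le> S c (b + c) \<omega>"
      using S_upper[OF \<omega>, of "sup_loc X T2 \<omega>" c "b + c"] props(2) t ab by simp
    show "S c (T1 + c) \<omega> \<le> S c (b + c) \<omega>"
      using S_mono[OF \<omega>, of 0 c "T1 + c" T2] c T ge by simp
    have "S c (a + c) \<omega> < S 0 T2 \<omega>"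
      using S_less_iff[OF \<omega>, of c "a + c"] props(3) t c ab by force
    then show "S c (a + c) \<omega> < S c (b + c) \<omega>" using ge by simp
  qed
  also have "\<dots> = prob {\<omega> \<in> space M. Q (\<lambda>i\<in>J. S (l i) (r i) \<omega>)}"
    by (rule S_shift_prob[OF _ _ Qm]) (use ab in \<open>auto simp: J_def l_def r_def\<close>)
  also have "\<dots> = prob {\<omega> \<in> space M. a < sup_loc X T1 \<omega> \<and> sup_loc X T1 \<omega> \<le> b}"
  proof -
    have "Q (\<lambda>i\<in>J. S (l i) (r i) \<omega>) \<longleftrightarrow> a < sup_loc X T1 \<omega> \<and> sup_loc X T1 \<omega> \<le> b"
      if \<omega>: "\<omega> \<in> space M" for \<omega>
      using Qc[of 0 \<omega>] sup_loc_le_iff[OF \<omega>, of a T1] sup_loc_le_iff[OF \<omega>, of b T1] ab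
        S_mono[OF \<omega>, of 0 0 b T1] by auto
    then show ?thesis by (auto intro!: arg_cong[where f=prob])
  qed
  also have "\<dots> = loc_cdf T1 b - loc_cdf T1 a" using loc_cdf_diff[OF T(1) ab(2)] by simp
  finally show ?thesis .
qed

text \<open>Translates of \<open>(t, t + h]\<close> tile an interval, so the shrinking inequality compares a small
  increment with the average increment over that interval.\<close>

lemma loc_cdf_tiles_upper:
  assumes h: "0 \<le> h" "real N * h \<le> T - T'" "real N * h \<le> t" "t \<le> T'"
  shows "real N * (loc_cdf T (t + h) - loc_cdf T t) \<le> loc_cdf T' t - loc_cdf T' (t - real N * h)"
proof -
  \<comment> \<open>The shift by \<open>(k + 1) h\<close> moves
    \<open>(t - (k + 1) h, t - k h]\<close> onto \<open>(t, t + h]\<close> and keeps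
    \<open>[0, T']\<close> inside \<open>[0, T]\<close>, because
    \<open>N h \<le> T - T'\<close>.\<close>
  have "loc_cdf T (t + h) - loc_cdf T t \<le> loc_cdf T' (t - real k * h) - loc_cdf T' (t - real (Suc k) * h)"
    if k: "k < N" for k
  proof -
    have "real (Suc k) * h \<le> real N * h" using k h(1) by (intro mult_right_mono) auto
    moreover have "0 \<le> real k * h" using h(1) by simp
    then have "t - real k * h \<le> T'" using h(4) by linarith
    ultimately show ?thesis
      using loc_cdf_shrink[of "real (Suc k) * h" T' T "t - real (Suc k) * h" "t - real k * h"] h
      by (simp add: algebra_simps)
  qed
  then have "(\<Sum>k<N. loc_cdf T (t + h) - loc_cdf T t) \<le>
      (\<Sum>k<N. loc_cdf T' (t - real k * h) - loc_cdf T' (t - real (Suc k) * h))"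
    by (intro sum_mono) auto
  also have "\<dots> = loc_cdf T' t - loc_cdf T' (t - real N * h)"
    by (subst sum_lessThan_telescope'[of "\<lambda>k. loc_cdf T' (t - real k * h)"]) simp
  finally show ?thesis by simp
qed

text \<open>Here the tiles lie to the right of \<open>t\<close> in the longer horizon
  \<open>T'\<close>; shifting the window \<open>[0, T]\<close> by \<open>k h\<close> moves
  \<open>(t, t + h]\<close> onto the tile with index \<open>k\<close>.\<close>

lemma loc_cdf_tiles_lower:
  assumes h: "0 \<le> h" "real N * h \<le> T' - T" "0 \<le> t" "t + h \<le> T"
  shows "loc_cdf T' (t + real N * h) - loc_cdf T' t \<le> real N * (loc_cdf T (t + h) - loc_cdf T t)"
proof -
  have "loc_cdf T' (t + real (Suc k) * h) - loc_cdf T' (t + real k * h) \<le> loc_cdf T (t + h) - loc_cdf T t"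
    if k: "k < N" for k
  proof -
    have "real k * h \<le> real N * h" using k h(1) by (intro mult_right_mono) auto
    moreover have k0: "t - real k * h \<le> t" using h(1) by simp
    ultimately show ?thesis
      using loc_cdf_shrink[of "real k * h" T T' t "t + h"] h
      by (simp add: algebra_simps)
  qed
  then have "(\<Sum>k<N. loc_cdf T' (t + real (Suc k) * h) - loc_cdf T' (t + real k * h)) \<le>
      (\<Sum>k<N. loc_cdf T (t + h) - loc_cdf T t)"
    by (intro sum_mono) auto
  also have "(\<Sum>k<N. loc_cdf T' (t + real (Suc k) * h) - loc_cdf T' (t + real k * h)) =
      loc_cdf T' (t + real N * h) - loc_cdf T' t"
    by (subst sum_lessThan_telescope[of "\<lambda>k. loc_cdf T' (t + real k * h)"]) simp
  finally show ?thesis by simp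
qed

text \<open>The \<open>N\<close> tiles for the horizon \<open>T - N h\<close> have total mass at
  most \<open>1\<close>. This is what makes the short gaps negligible without any mixing.\<close>

lemma loc_cdf_gap:
  assumes "0 \<le> h" "0 < N" "real N * h \<le> t" "t + real N * h \<le> T"
  shows "loc_cdf T (t + h) - loc_cdf T t \<le> 1 / real N"
proof -
  have "real N * (loc_cdf T (t + h) - loc_cdf T t) \<le> 1"
    using loc_cdf_tiles_upper[of h N T "T - real N * h" t] assms
      loc_cdf_le_1[of "T - real N * h" t] loc_cdf_nonneg[of "T - real N * h" "t - real N * h"] by simp
  then show ?thesis using assms(2) by (simp add: field_simps)
qed

section \<open>From increments of the distribution function to the density\<close>

lemma density_increment:
  assumes f: "sup_loc_density M X T f" and t: "0 < t" "0 \<le> h" "t + h < T"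
  shows "ennreal (loc_cdf T (t + h) - loc_cdf T t) = (\<integral>\<^sup>+x. ennreal (f x) * indicator {t<..t + h} x \<partial>lborel)"
proof -
  have T: "0 \<le> T" using t by simp
  note [measurable] = sup_loc_measurable[OF T]
  let ?I = "{t<..t + h}" and ?R = "{0<..<T}"
  have I: "?I \<subseteq> ?R" using t by auto
  have fm[measurable]: "f \<in> borel_measurable (restrict_space borel ?R)"
    and eq: "restrict_space (distr M borel (sup_loc X T)) ?R = density (restrict_space lborel ?R) (\<lambda>t. ennreal (f t))"
    using f by (auto simp: sup_loc_density_def)
  have fm': "f \<in> borel_measurable (restrict_space lborel ?R)"
    using fm by (simp cong: measurable_cong_sets add: sets_restrict_space)
  have "ennreal (loc_cdf T (t + h) - loc_cdf T t) = emeasure (distr M borel (sup_loc X T)) ?I"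
    using t T by (subst loc_cdf_diff) (auto simp: emeasure_distr emeasure_eq_measure vimage_def Int_def conj_commute conj_left_commute intro!: arg_cong[where f=prob])
  also have "\<dots> = emeasure (restrict_space (distr M borel (sup_loc X T)) ?R) ?I"
    using I by (subst emeasure_restrict_space) auto
  also have "\<dots> = (\<integral>\<^sup>+x. ennreal (f x) * indicator ?I x \<partial>restrict_space lborel ?R)"
    unfolding eq using I fm' by (subst emeasure_density) (auto simp: sets_restrict_space_iff)
  also have "\<dots> = (\<integral>\<^sup>+x. ennreal (f x) * indicator ?I x * indicator ?R x \<partial>lborel)"
    by (subst nn_integral_restrict_space) auto
  also have "\<dots> = (\<integral>\<^sup>+x. ennreal (f x) * indicator ?I x \<partial>lborel)"
    using I by (intro nn_integral_cong) (auto simp: indicator_def)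
  finally show ?thesis .
qed

lemma density_increment_le:
  assumes f: "sup_loc_density M X T f" and t: "0 < t" "0 \<le> h" "t + h < T"
    and c: "0 \<le> c" "\<And>x. x \<in> {t<..t + h} \<Longrightarrow> f x \<le> c"
  shows "loc_cdf T (t + h) - loc_cdf T t \<le> c * h"
proof -
  have "ennreal (loc_cdf T (t + h) - loc_cdf T t) \<le> (\<integral>\<^sup>+x. ennreal c * indicator {t<..t + h} x \<partial>lborel)"
    unfolding density_increment[OF f t]
    using c by (intro nn_integral_mono) (auto simp: indicator_def intro!: ennreal_leI)
  also have "\<dots> = ennreal (c * h)" using t c by (simp add: nn_integral_cmult ennreal_mult)
  finally show ?thesis using t c by simp
qed

lemma density_increment_ge:
  assumes f: "sup_loc_density M X T f" and t: "0 < t" "0 \<le> h" "t + h < T"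
    and c: "0 \<le> c" "\<And>x. x \<in> {t<..t + h} \<Longrightarrow> c \<le> f x"
  shows "c * h \<le> loc_cdf T (t + h) - loc_cdf T t"
proof -
  have "ennreal (c * h) = (\<integral>\<^sup>+x. ennreal c * indicator {t<..t + h} x \<partial>lborel)"
    using t c by (simp add: nn_integral_cmult ennreal_mult)
  also have "\<dots> \<le> ennreal (loc_cdf T (t + h) - loc_cdf T t)"
    unfolding density_increment[OF f t]
    using c by (intro nn_integral_mono) (auto simp: indicator_def intro!: ennreal_leI)
  finally show ?thesis using t c loc_cdf_mono[of T t "t + h"] by (subst (asm) ennreal_le_iff) auto
qed

text \<open>The step is taken of the form \<open>H / N\<close> so that \<open>N\<close> tiles fill
  the averaging length \<open>H\<close> exactly.\<close>

lemma density_right_limit: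
  assumes f: "sup_loc_density M X T f" and t: "0 < t" "t < T" and \<delta>: "0 < \<delta>" and H: "0 < H"
  obtains N :: nat where "0 < N" "t + H / real N < T"
    "\<And>x. x \<in> {t<..t + H / real N} \<Longrightarrow> \<bar>f x - f t\<bar> < \<delta>"
proof -
  have "(f \<longlongrightarrow> f t) (at_right t)"
    using f t by (auto simp: sup_loc_density_def continuous_within)
  then have "\<forall>\<^sub>F x in at_right t. dist (f x) (f t) < \<delta>" using \<delta> by (rule tendstoD)
  then obtain b where b: "t < b" "\<And>y. t < y \<Longrightarrow> y < b \<Longrightarrow> dist (f y) (f t) < \<delta>"
    unfolding eventually_at_right_field by blast
  obtain N :: nat where N: "H / (min b T - t) < real N" using reals_Archimedean2 by blast
  have pos: "0 < min b T - t" using b t by simp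
  then have "0 < real N" using N H by (meson divide_pos_pos less_trans)
  moreover have "H / real N < min b T - t"
    using N \<open>0 < real N\<close> pos by (simp only: pos_divide_less_eq mult.commute)
  then have "t + H / real N < min b T" by linarith
  ultimately show ?thesis using b(2) by (intro that[of N]) (auto simp: dist_real_def)
qed

text \<open>Otherwise some \<open>c\<close> lies strictly between the average and
  \<open>f t\<close>, and right continuity keeps \<open>f\<close> above \<open>c\<close> just to the
  right of \<open>t\<close>. The increment there exceeds \<open>c H / N\<close> or equals it, and
  \<open>N\<close> tiles give an average of at least \<open>c\<close>.\<close>

lemma density_le_average:
  assumes f: "sup_loc_density M X T f" and t: "0 < t" "t < T"
    and H: "0 < H" "H \<le> T - T'" "H \<le> t" "t \<le> T'"
  shows "f t * H \<le> loc_cdf T' t - loc_cdf T' (t - H)"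
proof (rule ccontr)
  define D where "D = loc_cdf T' t - loc_cdf T' (t - H)"
  assume "\<not> ?thesis"
  then have gt: "D / H < f t" using H by (simp add: D_def field_simps not_le)
  have D: "0 \<le> D" unfolding D_def using loc_cdf_mono[of T' "t - H" t] H t by simp
  obtain c where c: "D / H < c" "c < f t" using dense[OF gt] by blast
  then have c0: "0 < c" using D H by (meson divide_nonneg_pos le_less_trans)
  obtain N :: nat where N: "0 < N" "t + H / real N < T"
    "\<And>x. x \<in> {t<..t + H / real N} \<Longrightarrow> \<bar>f x - f t\<bar> < f t - c"
    using density_right_limit[OF f t, of "f t - c" H] c(2) H(1) by auto
  have "c * (H / real N) \<le> loc_cdf T (t + H / real N) - loc_cdf T t"
    using N c0 H t by (intro density_increment_ge[OF f]) (force+)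
  then have "c * H \<le> real N * (loc_cdf T (t + H / real N) - loc_cdf T t)"
    using N(1) by (simp add: field_simps)
  also have "\<dots> \<le> D"
    using loc_cdf_tiles_upper[of "H / real N" N T T' t] N(1) H by (simp add: D_def)
  finally show False using c(1) H by (simp add: field_simps)
qed

text \<open>Mirror image of the previous argument: a level \<open>c\<close> between
  \<open>f t\<close> and a larger average bounds a small increment from above, against the tiles of
  the longer horizon.\<close>

lemma density_ge_average:
  assumes f: "sup_loc_density M X T f" and t: "0 < t" "t < T" and H: "0 < H" "H \<le> T' - T"
  shows "loc_cdf T' (t + H) - loc_cdf T' t \<le> f t * H"
proof (rule ccontr)
  define D where "D = loc_cdf T' (t + H) - loc_cdf T' t"
  assume "\<not> ?thesis"
  then have gt: "f t < D / H" using H by (simp add: D_def field_simps not_le)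
  have f0: "0 \<le> f t" using f t by (auto simp: sup_loc_density_def)
  obtain c where c: "c < D / H" "f t < c" using dense[OF gt] by blast
  obtain N :: nat where N: "0 < N" "t + H / real N < T"
    "\<And>x. x \<in> {t<..t + H / real N} \<Longrightarrow> \<bar>f x - f t\<bar> < c - f t"
    using density_right_limit[OF f t, of "c - f t" H] c(2) H(1) by auto
  have "loc_cdf T (t + H / real N) - loc_cdf T t \<le> c * (H / real N)"
    using N c f0 H t by (intro density_increment_le[OF f]) (force+)
  then have "real N * (loc_cdf T (t + H / real N) - loc_cdf T t) \<le> c * H"
    using N(1) by (simp add: field_simps)
  moreover have "D \<le> real N * (loc_cdf T (t + H / real N) - loc_cdf T t)"
    using loc_cdf_tiles_lower[of "H / real N" N T' T t] N H t by (simp add: D_def)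
  ultimately show False using c(1) H by (simp add: field_simps)
qed

end

section \<open>The largest of several nearly independent variables\<close>

text \<open>By inner regularity it suffices to treat compact \<open>C \<subseteq> Q\<close>. With
  \<open>a\<close> and \<open>b\<close> its extreme points, \<open>C\<close> is contained in
  \<open>{a}\<close> together with \<open>(a, b]\<close>: the first costs an atom, the second a
  difference of the distribution function at two points of \<open>Q\<close>.\<close>

lemma (in prob_space) prob_cdf_window:
  fixes V :: "'a \<Rightarrow> real"
  assumes V[measurable]: "V \<in> borel_measurable M" and Q[measurable]: "Q \<in> sets borel"
    and atoms: "\<And>x. prob {\<omega> \<in> space M. V \<omega> = x} \<le> \<epsilon>" and \<delta>: "0 \<le> \<delta>"
    and window: "\<And>v w. v \<in> Q \<Longrightarrow> w \<in> Q \<Longrightarrow>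
      prob {\<omega> \<in> space M. V \<omega> \<le> w} - prob {\<omega> \<in> space M. V \<omega> \<le> v} \<le> \<delta>"
  shows "prob {\<omega> \<in> space M. V \<omega> \<in> Q} \<le> \<delta> + \<epsilon>"
proof -
  have \<epsilon>: "0 \<le> \<epsilon>" using atoms[of 0] measure_nonneg order_trans by blast
  let ?D = "distr M borel V"
  interpret D: prob_space ?D by (rule prob_space_distr) simp
  have D: "measure ?D B = prob {\<omega> \<in> space M. V \<omega> \<in> B}" if "B \<in> sets borel" for B
    using that by (auto simp: measure_distr vimage_def Int_def conj_commute)
  have "emeasure ?D C \<le> ennreal (\<delta> + \<epsilon>)" if C: "C \<subseteq> Q" "compact C" for C
  proof (cases "C = {}")
    case False
    obtain a where a: "a \<in> C" "\<forall>t\<in>C. a \<le> t" using compact_attains_inf[OF C(2) False] by blast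
    obtain b where b: "b \<in> C" "\<forall>t\<in>C. t \<le> b" using compact_attains_sup[OF C(2) False] by blast
    have ab: "a \<le> b" using a b by blast
    have "measure ?D C \<le> measure ?D ({..b} - {..a} \<union> {a})"
      using a b by (intro D.finite_measure_mono) force+
    also have "\<dots> \<le> measure ?D ({..b} - {..a}) + measure ?D {a}"
      by (intro measure_Un_le) auto
    also have "measure ?D ({..b} - {..a}) = measure ?D {..b} - measure ?D {..a}"
      using ab by (intro D.finite_measure_Diff) auto
    also have "\<dots> \<le> \<delta>" using window[of a b] a b C by (auto simp: D)
    also have "measure ?D {a} \<le> \<epsilon>" using atoms[of a] by (simp add: D)
    finally show ?thesis unfolding D.emeasure_eq_measure by (intro ennreal_leI) simp
  qed simp
  then have "emeasure ?D Q \<le> ennreal (\<delta> + \<epsilon>)"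
    by (subst inner_regular) (auto intro!: SUP_least simp del: ennreal_plus)
  then have "measure ?D Q \<le> \<delta> + \<epsilon>"
    unfolding D.emeasure_eq_measure using \<delta> \<epsilon> by (subst (asm) ennreal_le_iff) auto
  then show ?thesis by (simp add: D)
qed

text \<open>The line is cut into \<open>K + 1\<close> cells of small probability, by the value of the common
  distribution function.  Up to ties within a cell, the event that \<open>V i\<close> is the strict maximum is
  a disjoint union of rectangles, whose product probabilities do not depend on \<open>i\<close>.\<close>

lemma (in prob_space) strict_argmax_prob_ge:
  fixes V :: "nat \<Rightarrow> 'a \<Rightarrow> real" and n K :: nat
  assumes V[measurable]: "\<And>i. i < n \<Longrightarrow> V i \<in> borel_measurable M"
    and rect: "\<And>C. (\<And>i. C i \<in> sets borel) \<Longrightarrow>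
      \<bar>prob {\<omega> \<in> space M. \<forall>i<n. V i \<omega> \<in> C i} - (\<Prod>i<n. prob {\<omega> \<in> space M. V 0 \<omega> \<in> C i})\<bar> \<le> \<beta>"
    and atoms: "\<And>x. prob {\<omega> \<in> space M. V 0 \<omega> = x} \<le> \<epsilon>"
    and K: "0 < K" and i: "i < n"
  shows "1 / real n - (real n * (1 / real K + \<epsilon>) + (real n + 2) * (real K + 1) * \<beta>)
    \<le> prob {\<omega> \<in> space M. \<forall>j<n. j \<noteq> i \<longrightarrow> V j \<omega> < V i \<omega>}"
proof -
  have n: "0 < n" using i by simp
  have V0[measurable]: "V 0 \<in> borel_measurable M" using V n by simp
  have \<epsilon>: "0 \<le> \<epsilon>" using atoms[of 0] measure_nonneg order_trans by blast
  define F where "F = (\<lambda>v. prob {\<omega> \<in> space M. V 0 \<omega> \<le> v})"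
  \<comment> \<open>Index of the cell of \<open>v\<close>. The value \<open>K\<close> occurs where
    \<open>F v = 1\<close>, which accounts for \<open>K + 1\<close> cells.\<close>
  define l where "l = (\<lambda>v. nat \<lfloor>real K * F v\<rfloor>)"
  have F: "0 \<le> F v" "F v \<le> 1" for v by (simp_all add: F_def)
  have "mono F" unfolding F_def by (intro monoI finite_measure_mono) auto
  then have l_mono: "mono l"
    unfolding l_def mono_def by (auto intro!: nat_mono floor_mono mult_left_mono)
  have [measurable]: "F \<in> borel_measurable borel" using \<open>mono F\<close> by (rule borel_measurable_mono)
  have l_meas[measurable]: "l \<in> measurable borel (count_space UNIV)" unfolding l_def by measurable
  have lK: "l v \<le> K" for v
  proof -
    have "\<lfloor>real K * F v\<rfloor> \<le> \<lfloor>real K\<rfloor>" using F(2)[of v] by (intro floor_mono) (simp add: mult_left_le)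
    then show ?thesis by (simp add: l_def)
  qed
  define p where "p = (\<lambda>C. prob {\<omega> \<in> space M. V 0 \<omega> \<in> C})"
  define cell where "cell = (\<lambda>k. {v. l v = k})"
  define low where "low = (\<lambda>k. {v. l v < k})"
  have [measurable]: "cell k \<in> sets borel" "low k \<in> sets borel" for k
    unfolding cell_def low_def by measurable
  have p_cell: "p (cell k) \<le> 1 / real K + \<epsilon>" for k
    unfolding p_def
  proof (rule prob_cdf_window)
    fix v w assume "v \<in> cell k" "w \<in> cell k"
    then have "nat \<lfloor>real K * F v\<rfloor> = nat \<lfloor>real K * F w\<rfloor>" by (auto simp: cell_def l_def)
    then have "\<lfloor>real K * F v\<rfloor> = \<lfloor>real K * F w\<rfloor>" using F by (subst (asm) eq_nat_nat_iff) auto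
    then have "real K * F w - real K * F v \<le> 1" by linarith
    then have "F w - F v \<le> 1 / real K" using K by (simp add: field_simps)
    then show "prob {\<omega> \<in> space M. V 0 \<omega> \<le> w} - prob {\<omega> \<in> space M. V 0 \<omega> \<le> v} \<le> 1 / real K"
      by (simp add: F_def)
  qed (use atoms in auto)
  have p_sum: "(\<Sum>k\<le>K. p (cell k)) = 1"
  proof -
    have "(\<Sum>k\<le>K. p (cell k)) = prob (\<Union>k\<le>K. {\<omega> \<in> space M. V 0 \<omega> \<in> cell k})"
      unfolding p_def by (subst finite_measure_finite_Union) (auto simp: disjoint_family_on_def cell_def)
    also have "(\<Union>k\<le>K. {\<omega> \<in> space M. V 0 \<omega> \<in> cell k}) = space M" using lK by (auto simp: cell_def)
    finally show ?thesis by (simp add: prob_space)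
  qed
  \<comment> \<open>The product-law value of the probability that a given variable alone has the
    highest cell: it sits in cell \<open>k\<close> and the other \<open>n - 1\<close> variables lie
    in lower cells.\<close>
  define r where "r = (\<Sum>k\<le>K. p (cell k) * p (low k) ^ (n - 1))"
  define R where "R = (\<lambda>i. {\<omega> \<in> space M. \<forall>j<n. j \<noteq> i \<longrightarrow> l (V j \<omega>) < l (V i \<omega>)})"
  have lV: "(\<lambda>\<omega>. real (l (V i \<omega>))) \<in> borel_measurable M" if "i < n" for i
    using measurable_compose[OF V[OF that] l_meas] by (rule measurable_compose) simp
  have R_sets: "R i \<in> sets M" if "i < n" for i
  proof -
    have "{\<omega> \<in> space M. \<forall>j\<in>{..<n}. j \<noteq> i \<longrightarrow> l (V j \<omega>) < l (V i \<omega>)} \<in> sets M"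
    proof (rule sets.sets_Collect_finite_All)
      fix j assume "j \<in> {..<n}"
      then show "{\<omega> \<in> space M. j \<noteq> i \<longrightarrow> l (V j \<omega>) < l (V i \<omega>)} \<in> sets M"
        using borel_measurable_less[OF lV[of j] lV[of i], unfolded of_nat_less_iff] that
        by (cases "j = i") simp_all
    qed simp
    then show ?thesis unfolding R_def Ball_def lessThan_iff .
  qed
  have R_r: "\<bar>prob (R i) - r\<bar> \<le> (real K + 1) * \<beta>" if i: "i < n" for i
  proof -
    define C where "C = (\<lambda>k j. if j = i then cell k else low k)"
    have C[measurable]: "C k j \<in> sets borel" for k j by (simp add: C_def)
    define RR where "RR = (\<lambda>k. {\<omega> \<in> space M. \<forall>j<n. V j \<omega> \<in> C k j})"
    have sets: "RR k \<in> sets M" for k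
    proof -
      have "{\<omega> \<in> space M. \<forall>j\<in>{..<n}. V j \<omega> \<in> C k j} \<in> sets M"
      proof (rule sets.sets_Collect_finite_All)
        fix j assume "j \<in> {..<n}"
        then have "j < n" by simp
        from measurable_sets[OF V[OF this] C[of k j]]
        show "{\<omega> \<in> space M. V j \<omega> \<in> C k j} \<in> sets M" by (simp add: vimage_def Int_def conj_commute)
      qed simp
      then show ?thesis unfolding RR_def Ball_def lessThan_iff .
    qed
    have "R i = (\<Union>k\<le>K. RR k)"
    proof (intro set_eqI iffI)
      fix \<omega> assume "\<omega> \<in> R i"
      then have "\<omega> \<in> RR (l (V i \<omega>))" by (auto simp: R_def RR_def C_def cell_def low_def)
      then show "\<omega> \<in> (\<Union>k\<le>K. RR k)" using lK by blast
    next
      fix \<omega> assume "\<omega> \<in> (\<Union>k\<le>K. RR k)"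
      then obtain k where k: "\<omega> \<in> space M" "\<And>j. j < n \<Longrightarrow> V j \<omega> \<in> C k j" by (auto simp: RR_def)
      have "l (V i \<omega>) = k" using k(2)[OF i] by (simp add: C_def cell_def)
      moreover have "l (V j \<omega>) < k" if "j < n" "j \<noteq> i" for j
        using k(2)[OF that(1)] that(2) by (simp add: C_def low_def)
      ultimately show "\<omega> \<in> R i" using k(1) by (simp add: R_def)
    qed
    moreover have "disjoint_family_on RR {..K}"
      using i by (auto simp: disjoint_family_on_def RR_def C_def cell_def split: if_splits)
    ultimately have eq: "prob (R i) = (\<Sum>k\<le>K. prob (RR k))"
      using sets by (simp add: finite_measure_finite_Union image_subset_iff)
    have "(\<Prod>j<n. p (C k j)) = p (cell k) * p (low k) ^ (n - 1)" for k
    proof -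
      have "(\<Prod>j<n. p (C k j)) = p (C k i) * (\<Prod>j\<in>{..<n} - {i}. p (C k j))"
        using i by (intro prod.remove) auto
      also have "(\<Prod>j\<in>{..<n} - {i}. p (C k j)) = (\<Prod>j\<in>{..<n} - {i}. p (low k))"
        by (intro prod.cong) (auto simp: C_def)
      finally show ?thesis using i by (simp add: C_def)
    qed
    then have "\<bar>prob (R i) - r\<bar> = \<bar>\<Sum>k\<le>K. prob (RR k) - (\<Prod>j<n. p (C k j))\<bar>"
      by (simp add: eq r_def sum_subtractf)
    also have "\<dots> \<le> (\<Sum>k\<le>K. \<bar>prob (RR k) - (\<Prod>j<n. p (C k j))\<bar>)" by (rule sum_abs)
    also have "\<dots> \<le> (\<Sum>k\<le>K. \<beta>)" unfolding RR_def p_def by (intro sum_mono rect C)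
    finally show ?thesis by (simp add: algebra_simps)
  qed
  have R_le: "prob (R i) \<le> r + (real K + 1) * \<beta>" if "i < n" for i
    using R_r[OF that] by linarith
  define TT where "TT = (\<lambda>i j k. {\<omega> \<in> space M. V i \<omega> \<in> cell k \<and> V j \<omega> \<in> cell k})"
  have TT_sets: "TT i j k \<in> sets M" if "i < n" "j < n" for i j k
    unfolding TT_def using V[OF that(1)] V[OF that(2)] by measurable
  have TT_le: "prob (TT i j k) \<le> (1 / real K + \<epsilon>) * p (cell k) + \<beta>" if ij: "i < n" "j < n" "i \<noteq> j" for i j k
  proof -
    define C where "C = (\<lambda>m. if m \<in> {i, j} then cell k else UNIV)"
    have Cm: "C m \<in> sets borel" for m by (simp add: C_def)
    have "TT i j k = {\<omega> \<in> space M. \<forall>m<n. V m \<omega> \<in> C m}" using ij by (auto simp: TT_def C_def)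
    then have "prob (TT i j k) \<le> (\<Prod>m<n. p (C m)) + \<beta>"
      using rect[of C] Cm unfolding p_def by (simp add: abs_le_iff)
    also have "(\<Prod>m<n. p (C m)) = (\<Prod>m\<in>{i, j}. p (C m))"
      using ij by (intro prod.mono_neutral_right) (auto simp: C_def p_def prob_space)
    also have "\<dots> = p (cell k) * p (cell k)" using ij by (simp add: C_def)
    also have "\<dots> \<le> (1 / real K + \<epsilon>) * p (cell k)"
      by (intro mult_right_mono p_cell) (simp add: p_def)
    finally show ?thesis by simp
  qed
  \<comment> \<open>Bounds the probability that two given variables share a cell: the cell
    probabilities sum to \<open>1\<close>, and each of the \<open>K + 1\<close> cells adds one error
    \<open>\<beta>\<close>.\<close>
  define t where "t = (1 / real K + \<epsilon>) + (real K + 1) * \<beta>"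
  have \<beta>: "0 \<le> \<beta>" using rect[of "\<lambda>_. UNIV"] by (simp add: prob_space)
  have t0: "0 \<le> t" using \<beta> \<epsilon> by (simp add: t_def)
  \<comment> \<open>The highest occupied cell contains either one variable or at least two.\<close>
  have cover: "space M \<subseteq> (\<Union>i<n. R i) \<union> (\<Union>i<n. \<Union>j\<in>{..<n} - {i}. \<Union>k\<le>K. TT i j k)"
  proof
    fix \<omega> assume \<omega>: "\<omega> \<in> space M"
    have "Max ((\<lambda>i. l (V i \<omega>)) ` {..<n}) \<in> (\<lambda>i. l (V i \<omega>)) ` {..<n}" using n by (intro Max_in) auto
    then obtain i where i: "i < n" "Max ((\<lambda>i. l (V i \<omega>)) ` {..<n}) = l (V i \<omega>)" by auto
    have max: "l (V j \<omega>) \<le> l (V i \<omega>)" if "j < n" for j using that i(2) by (metis Max_ge finite_imageI finite_lessThan imageI lessThan_iff)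
    show "\<omega> \<in> (\<Union>i<n. R i) \<union> (\<Union>i<n. \<Union>j\<in>{..<n} - {i}. \<Union>k\<le>K. TT i j k)"
    proof (cases "\<exists>j<n. j \<noteq> i \<and> l (V j \<omega>) = l (V i \<omega>)")
      case True
      then obtain j where "j < n" "j \<noteq> i" "l (V j \<omega>) = l (V i \<omega>)" by blast
      then have "\<omega> \<in> TT i j (l (V i \<omega>))" using \<omega> by (simp add: TT_def cell_def)
      then show ?thesis using i(1) \<open>j < n\<close> \<open>j \<noteq> i\<close> lK by blast
    next
      case False
      then have "\<omega> \<in> R i" using \<omega> max by (auto simp: R_def order_less_le)
      then show ?thesis using i by blast
    qed
  qed
  have tie: "prob (\<Union>i<n. \<Union>j\<in>{..<n} - {i}. \<Union>k\<le>K. TT i j k) \<le> real n * (real n * t)"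
  proof -
    have 1: "prob (\<Union>k\<le>K. TT i j k) \<le> t" if ij: "i < n" "j < n" "i \<noteq> j" for i j
    proof -
      have "prob (\<Union>k\<le>K. TT i j k) \<le> (\<Sum>k\<le>K. prob (TT i j k))"
        using ij by (intro finite_measure_subadditive_finite) (auto intro: TT_sets)
      also have "\<dots> \<le> (\<Sum>k\<le>K. (1 / real K + \<epsilon>) * p (cell k) + \<beta>)" by (intro sum_mono TT_le ij)
      also have "\<dots> = t" using p_sum by (simp add: sum.distrib flip: sum_distrib_left) (simp add: t_def)
      finally show ?thesis .
    qed
    have 2: "prob (\<Union>j\<in>{..<n} - {i}. \<Union>k\<le>K. TT i j k) \<le> real n * t" if i: "i < n" for i
    proof -
      have "prob (\<Union>j\<in>{..<n} - {i}. \<Union>k\<le>K. TT i j k) \<le> (\<Sum>j\<in>{..<n} - {i}. prob (\<Union>k\<le>K. TT i j k))"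
        using i by (intro finite_measure_subadditive_finite) (auto intro!: TT_sets)
      also have "\<dots> \<le> (\<Sum>j\<in>{..<n} - {i}. t)" using 1 i by (intro sum_mono) auto
      also have "\<dots> \<le> real n * t" using t0 i by (simp add: mult_right_mono)
      finally show ?thesis .
    qed
    have "prob (\<Union>i<n. \<Union>j\<in>{..<n} - {i}. \<Union>k\<le>K. TT i j k) \<le> (\<Sum>i<n. prob (\<Union>j\<in>{..<n} - {i}. \<Union>k\<le>K. TT i j k))"
      by (intro finite_measure_subadditive_finite) (auto intro!: TT_sets)
    also have "\<dots> \<le> (\<Sum>i<n. real n * t)" using 2 by (intro sum_mono) auto
    finally show ?thesis by simp
  qed
  have "1 \<le> prob ((\<Union>i<n. R i) \<union> (\<Union>i<n. \<Union>j\<in>{..<n} - {i}. \<Union>k\<le>K. TT i j k))"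
    using cover finite_measure_mono[OF cover] by (auto simp: prob_space intro!: R_sets TT_sets)
  also have "\<dots> \<le> prob (\<Union>i<n. R i) + prob (\<Union>i<n. \<Union>j\<in>{..<n} - {i}. \<Union>k\<le>K. TT i j k)"
    by (intro measure_Un_le) (auto intro!: R_sets TT_sets)
  also have "prob (\<Union>i<n. R i) \<le> (\<Sum>i<n. prob (R i))"
    by (intro finite_measure_subadditive_finite) (auto intro: R_sets)
  also have "\<dots> \<le> (\<Sum>i<n. r + (real K + 1) * \<beta>)" using R_le by (intro sum_mono) auto
  finally have "1 \<le> real n * (r + (real K + 1) * \<beta>) + real n * (real n * t)" using tie by simp
  \<comment> \<open>The cover bounds \<open>r\<close> from below by \<open>1 / n\<close> up to
    errors, although only the sum over all indices is controlled. Since each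
    \<open>prob (R i)\<close> is close to the same \<open>r\<close>, the bound passes to the
    individual index.\<close>
  then have "1 / real n \<le> r + (real K + 1) * \<beta> + real n * t"
    using n by (simp add: field_simps)
  then have "1 / real n - (real n * (1 / real K + \<epsilon>) + (real n + 2) * (real K + 1) * \<beta>) \<le> r - (real K + 1) * \<beta>"
    by (simp add: t_def algebra_simps)
  also have "\<dots> \<le> prob (R i)" using R_r[OF i] by (auto simp: abs_le_iff)
  also have "\<dots> \<le> prob {\<omega> \<in> space M. \<forall>j<n. j \<noteq> i \<longrightarrow> V j \<omega> < V i \<omega>}"
  proof (rule finite_measure_mono)
    show "R i \<subseteq> {\<omega> \<in> space M. \<forall>j<n. j \<noteq> i \<longrightarrow> V j \<omega> < V i \<omega>}"
      unfolding R_def using l_mono by (auto simp: mono_def not_le[symmetric])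
    have "{\<omega> \<in> space M. \<forall>j\<in>{..<n}. j \<noteq> i \<longrightarrow> V j \<omega> < V i \<omega>} \<in> sets M"
    proof (rule sets.sets_Collect_finite_All)
      fix j assume "j \<in> {..<n}"
      then show "{\<omega> \<in> space M. j \<noteq> i \<longrightarrow> V j \<omega> < V i \<omega>} \<in> sets M"
        using borel_measurable_less[OF V[of j] V[of i]] i by (cases "j = i") simp_all
    qed simp
    then show "{\<omega> \<in> space M. \<forall>j<n. j \<noteq> i \<longrightarrow> V j \<omega> < V i \<omega>} \<in> sets M" unfolding Ball_def lessThan_iff .
  qed
  finally show ?thesis .
qed

context usc_process
begin

section \<open>Mixing of block suprema\<close>

lemma truncated_measurable [measurable]: "truncated X u s \<in> borel_measurable M"
  unfolding truncated_def by measurable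

lemma generated_events_sigma_algebra: "sigma_algebra (space M) (generated_events M (truncated X u) K)"
  unfolding generated_events_def by (rule sigma_algebra_sigma_sets) auto

lemma generated_events_subset: "generated_events M (truncated X u) K \<subseteq> sets M"
  unfolding generated_events_def by (rule sets.sigma_sets_subset) (auto intro: measurable_sets truncated_measurable)

text \<open>Truncation sends values below \<open>\<phi>\<close> to \<open>0\<close>, which may itself be a value above \<open>\<phi>\<close>.  Above
  the level \<open>\<psi>\<close> and outside the null set \<open>N\<close> no information is lost.\<close>

definition resolves :: "'a set \<Rightarrow> real \<Rightarrow> real \<Rightarrow> bool" where
  "resolves N \<phi> \<psi> \<longleftrightarrow> N \<in> null_sets M \<and>
     (\<forall>u\<ge>\<psi>. \<exists>B\<in>sets borel. \<forall>s. \<forall>\<omega>\<in>space M - N. u < X s \<omega> \<longleftrightarrow> truncated X \<phi> s \<omega> \<in> B)"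

text \<open>Above a nonnegative level the recorded \<open>0\<close> cannot be mistaken for an
  exceedance, so \<open>B\<close> is a half-line.\<close>

lemma resolves_nonneg: "resolves {} \<phi> (max \<phi> 0)"
  unfolding resolves_def
proof (intro conjI allI impI)
  fix u assume "max \<phi> 0 \<le> u"
  then show "\<exists>B\<in>sets borel. \<forall>s. \<forall>\<omega>\<in>space M - {}. u < X s \<omega> \<longleftrightarrow> truncated X \<phi> s \<omega> \<in> B"
    by (intro bexI[of _ "{u<..}"]) (auto simp: truncated_def indicator_def)
qed simp

text \<open>For negative paths every retained value is negative and \<open>0\<close> marks a
  discarded one; cutting the half-line off at \<open>0\<close> removes the discarded values.\<close>

lemma resolves_neg:
  assumes "N \<in> null_sets M" and neg: "\<And>\<omega> s. \<omega> \<in> space M - N \<Longrightarrow> X s \<omega> < 0"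
  shows "resolves N \<phi> \<phi>"
  unfolding resolves_def
proof (intro conjI allI impI)
  fix u assume "\<phi> \<le> u"
  then show "\<exists>B\<in>sets borel. \<forall>s. \<forall>\<omega>\<in>space M - N. u < X s \<omega> \<longleftrightarrow> truncated X \<phi> s \<omega> \<in> B"
    using neg by (intro bexI[of _ "{u<..<0}"]) (auto simp: truncated_def indicator_def)
qed fact

text \<open>Induction over the Borel sets generated by open upper half-lines. For a level
  \<open>u \<ge> \<psi>\<close> the event is a countable union over a skeleton of events visible to
  the truncated process; below \<open>\<psi>\<close> the maximum with \<open>\<psi>\<close> makes it
  trivial.\<close>

lemma sup_event_generated:
  assumes N: "resolves N \<phi> \<psi>" and ab: "a \<le> b" "{a..b} \<subseteq> K" and C: "C \<in> sets borel"
  shows "\<exists>A\<in>generated_events M (truncated X \<phi>) K. \<forall>\<omega>\<in>space M - N. \<omega> \<in> A \<longleftrightarrow> max \<psi> (S a b \<omega>) \<in> C"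
proof -
  interpret G: sigma_algebra "space M" "generated_events M (truncated X \<phi>) K"
    by (rule generated_events_sigma_algebra)
  have "C \<in> sigma_sets UNIV (range greaterThan)"
    using C by (simp add: borel_Ioi)
  then show ?thesis
  proof (induction C rule: sigma_sets.induct)
    case (Basic C)
    then obtain u where u: "C = {u<..}" by blast
    show ?case
    proof (cases "\<psi> \<le> u")
      case False
      then show ?thesis by (intro bexI[of _ "space M"]) (auto simp: u)
    next
      case True
      obtain E where E: "skeleton a b E" using skeleton_exists[OF ab(1)] .
      then have E': "countable E" "E \<subseteq> K" using ab(2) by (auto simp: skeleton_def)
      obtain B where B: "B \<in> sets borel"
        "\<And>s \<omega>. \<omega> \<in> space M - N \<Longrightarrow> u < X s \<omega> \<longleftrightarrow> truncated X \<phi> s \<omega> \<in> B"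
        using N[unfolded resolves_def, THEN conjunct2, rule_format, OF True] by auto
      let ?A = "\<Union>e\<in>E. truncated X \<phi> e -` B \<inter> space M"
      have "?A \<in> generated_events M (truncated X \<phi>) K"
      proof (rule G.countable_UN'[OF E'(1)], rule image_subsetI)
        fix e assume "e \<in> E"
        then show "truncated X \<phi> e -` B \<inter> space M \<in> generated_events M (truncated X \<phi>) K"
          unfolding generated_events_def using E'(2) B(1) by (intro sigma_sets.Basic) blast
      qed
      moreover have "\<omega> \<in> ?A \<longleftrightarrow> max \<psi> (S a b \<omega>) \<in> C" if \<omega>: "\<omega> \<in> space M - N" for \<omega>
      proof -
        have "\<omega> \<in> ?A \<longleftrightarrow> (\<exists>e\<in>E. u < X e \<omega>)" using B(2)[OF \<omega>] \<omega> by auto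
        also have "\<dots> \<longleftrightarrow> u < S a b \<omega>" using skeleton_iff[OF E, of \<omega> u] \<omega> by simp
        finally show ?thesis using True by (simp add: u less_max_iff_disj)
      qed
      ultimately show ?thesis by blast
    qed
  next
    case Empty
    show ?case by (intro bexI[of _ "{}"]) auto
  next
    case (Compl C)
    then obtain A where "A \<in> generated_events M (truncated X \<phi>) K"
      "\<forall>\<omega>\<in>space M - N. \<omega> \<in> A \<longleftrightarrow> max \<psi> (S a b \<omega>) \<in> C" by blast
    then show ?case by (intro bexI[of _ "space M - A"]) auto
  next
    case (Union C)
    then obtain A where "\<And>i::nat. A i \<in> generated_events M (truncated X \<phi>) K"
      "\<And>i. \<forall>\<omega>\<in>space M - N. \<omega> \<in> A i \<longleftrightarrow> max \<psi> (S a b \<omega>) \<in> C i" by metis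
    then show ?case by (intro bexI[of _ "\<Union>i. A i"]) auto
  qed
qed

lemma sup_events_generated:
  assumes N: "resolves N \<phi> \<psi>" and J: "finite J"
    and ab: "\<And>i. i \<in> J \<Longrightarrow> a i \<le> b i" "\<And>i. i \<in> J \<Longrightarrow> {a i..b i} \<subseteq> K"
    and C: "\<And>i. C i \<in> sets borel"
  shows "\<exists>A\<in>generated_events M (truncated X \<phi>) K.
    \<forall>\<omega>\<in>space M - N. \<omega> \<in> A \<longleftrightarrow> (\<forall>i\<in>J. max \<psi> (S (a i) (b i) \<omega>) \<in> C i)"
  using J ab
proof (induction J rule: finite_induct)
  interpret G: sigma_algebra "space M" "generated_events M (truncated X \<phi>) K"
    by (rule generated_events_sigma_algebra)
  {
    case empty
    show ?case by (intro bexI[of _ "space M"]) auto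
  next
    case (insert j J)
    obtain A where A: "A \<in> generated_events M (truncated X \<phi>) K"
      "\<forall>\<omega>\<in>space M - N. \<omega> \<in> A \<longleftrightarrow> (\<forall>i\<in>J. max \<psi> (S (a i) (b i) \<omega>) \<in> C i)"
      using insert by auto
    obtain B where B: "B \<in> generated_events M (truncated X \<phi>) K"
      "\<forall>\<omega>\<in>space M - N. \<omega> \<in> B \<longleftrightarrow> max \<psi> (S (a j) (b j) \<omega>) \<in> C j"
      using sup_event_generated[OF N, of "a j" "b j" K "C j"] insert.prems C by auto
    show ?case using A B by (intro bexI[of _ "A \<inter> B"]) auto
  }
qed

definition mixing_coeff :: "real \<Rightarrow> real \<Rightarrow> real" where
  "mixing_coeff u t = (SUP (A, B) \<in> generated_events M (truncated X u) {..0} \<times> generated_events M (truncated X u) {t..}.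
     \<bar>prob (A \<inter> B) - prob A * prob B\<bar>)"

lemma mixing_coeff_upper:
  assumes "A \<in> generated_events M (truncated X u) {..0}" "B \<in> generated_events M (truncated X u) {t..}"
  shows "\<bar>prob (A \<inter> B) - prob A * prob B\<bar> \<le> mixing_coeff u t"
proof -
  have "\<bar>prob (A \<inter> B) - prob A * prob B\<bar> \<le> 1" for A B
  proof -
    have "0 \<le> prob A * prob B" "prob A * prob B \<le> 1" by (simp_all add: mult_le_one)
    moreover have "0 \<le> prob (A \<inter> B)" "prob (A \<inter> B) \<le> 1" by simp_all
    ultimately show ?thesis by linarith
  qed
  then have "bdd_above ((\<lambda>(A, B). \<bar>prob (A \<inter> B) - prob A * prob B\<bar>) `
      (generated_events M (truncated X u) {..0} \<times> generated_events M (truncated X u) {t..}))"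
    by (intro bdd_aboveI2[of _ _ 1]) auto
  from cSUP_upper[OF _ this, of "(A, B)"] show ?thesis
    using assms by (simp add: mixing_coeff_def)
qed

lemma sup_events_measurable:
  assumes J: "finite J" and ab: "\<And>i. i \<in> J \<Longrightarrow> a i \<le> b i" and C: "\<And>i. C i \<in> sets borel"
  shows "{\<omega> \<in> space M. \<forall>i\<in>J. max \<psi> (S (a i) (b i) \<omega>) \<in> C i} \<in> sets M"
proof (rule sets.sets_Collect_finite_All[OF _ J])
  fix i assume "i \<in> J"
  then have "(\<lambda>\<omega>. max \<psi> (S (a i) (b i) \<omega>)) \<in> borel_measurable M"
    using S_measurable[OF ab] by auto
  from measurable_sets[OF this C[of i]]
  show "{\<omega> \<in> space M. max \<psi> (S (a i) (b i) \<omega>) \<in> C i} \<in> sets M"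
    by (simp add: vimage_def Int_def conj_commute)
qed

lemma sup_events_shift:
  assumes J: "finite J" and ab: "\<And>i. i \<in> J \<Longrightarrow> a i \<le> b i" and C: "\<And>i. C i \<in> sets borel"
  shows "prob {\<omega> \<in> space M. \<forall>i\<in>J. max \<psi> (S (a i + c) (b i + c) \<omega>) \<in> C i} =
    prob {\<omega> \<in> space M. \<forall>i\<in>J. max \<psi> (S (a i) (b i) \<omega>) \<in> C i}"
proof -
  have "Measurable.pred (\<Pi>\<^sub>M i\<in>J. borel) (\<lambda>x. \<forall>i\<in>J. max \<psi> (x i) \<in> C i)"
  proof (rule pred_intros_finite(3)[OF J])
    fix i assume "i \<in> J"
    then have "(\<lambda>x. max \<psi> (x i)) \<in> borel_measurable (\<Pi>\<^sub>M i\<in>J. (borel :: real measure))"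
      by (intro borel_measurable_max measurable_component_singleton) auto
    then show "Measurable.pred (\<Pi>\<^sub>M i\<in>J. borel) (\<lambda>x. max \<psi> (x i) \<in> C i)"
      using C by (rule pred_sets2[rotated])
  qed
  from S_shift_prob[OF countable_finite[OF J] ab this, where c=c] show ?thesis by simp
qed

lemma sup_event_shift:
  assumes "a \<le> b" "C \<in> sets borel"
  shows "prob {\<omega> \<in> space M. S (a + c) (b + c) \<omega> \<in> C} = prob {\<omega> \<in> space M. S a b \<omega> \<in> C}"
proof -
  have "Measurable.pred (\<Pi>\<^sub>M i\<in>{()}. borel) (\<lambda>x. x () \<in> C)"
    by (rule pred_sets2[OF assms(2)], rule measurable_component_singleton) simp
  from S_shift_prob[OF _ _ this, of "\<lambda>_. a" "\<lambda>_. b", where c=c] show ?thesis using assms(1) by simp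
qed

lemma sup_events_almost_independent:
  assumes N: "resolves N \<phi> \<psi>" and J: "finite J" "j \<notin> J"
    and ab: "\<And>i. i \<in> insert j J \<Longrightarrow> a i \<le> b i"
    and gap: "\<And>i. i \<in> J \<Longrightarrow> b i + t \<le> a j"
    and C: "\<And>i. C i \<in> sets borel"
  shows "\<bar>prob {\<omega> \<in> space M. \<forall>i\<in>insert j J. max \<psi> (S (a i) (b i) \<omega>) \<in> C i} -
    prob {\<omega> \<in> space M. \<forall>i\<in>J. max \<psi> (S (a i) (b i) \<omega>) \<in> C i} *
    prob {\<omega> \<in> space M. max \<psi> (S (a j) (b j) \<omega>) \<in> C j}\<bar> \<le> mixing_coeff \<phi> t"
proof -
  \<comment> \<open>After this shift block \<open>j\<close> starts at \<open>t\<close> and the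
    blocks indexed by \<open>J\<close> end no later than \<open>0\<close>, as the mixing coefficient
    demands.\<close>
  define c where "c = t - a j"
  define W where "W = (\<lambda>J. {\<omega> \<in> space M. \<forall>i\<in>J. max \<psi> (S (a i + c) (b i + c) \<omega>) \<in> C i})"
  have W_sets: "W I \<in> sets M" if "I \<subseteq> insert j J" for I
    unfolding W_def using that ab J C by (intro sup_events_measurable) (auto intro: finite_subset)
  have W_shift: "prob (W I) = prob {\<omega> \<in> space M. \<forall>i\<in>I. max \<psi> (S (a i) (b i) \<omega>) \<in> C i}"
    if "I \<subseteq> insert j J" for I
    unfolding W_def using that ab J C by (intro sup_events_shift) (auto intro: finite_subset)
  have AE: "AE \<omega> in M. \<omega> \<notin> N" using N by (intro AE_not_in) (simp add: resolves_def)
  obtain A where A: "A \<in> generated_events M (truncated X \<phi>) {..0}"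
    "\<forall>\<omega>\<in>space M - N. \<omega> \<in> A \<longleftrightarrow> (\<forall>i\<in>J. max \<psi> (S (a i + c) (b i + c) \<omega>) \<in> C i)"
    using sup_events_generated[OF N J(1), of "\<lambda>i. a i + c" "\<lambda>i. b i + c" "{..0}" C] ab gap C
    by (force simp: c_def)
  obtain B where B: "B \<in> generated_events M (truncated X \<phi>) {t..}"
    "\<forall>\<omega>\<in>space M - N. \<omega> \<in> B \<longleftrightarrow> (\<forall>i\<in>{j}. max \<psi> (S (a i + c) (b i + c) \<omega>) \<in> C i)"
    using sup_events_generated[OF N, of "{j}" "\<lambda>i. a i + c" "\<lambda>i. b i + c" "{t..}" C] ab C
    by (force simp: c_def)
  have [measurable]: "A \<in> sets M" "B \<in> sets M" using A(1) B(1) generated_events_subset by blast+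
  have "prob A = prob (W J)"
    using AE A(2) W_sets[of J] by (intro finite_measure_eq_AE) (auto simp: W_def)
  moreover have "prob B = prob (W {j})"
    using AE B(2) W_sets[of "{j}"] by (intro finite_measure_eq_AE) (auto simp: W_def)
  moreover have "prob (A \<inter> B) = prob (W (insert j J))"
    using AE A(2) B(2) W_sets[of "insert j J"] by (intro finite_measure_eq_AE) (auto simp: W_def)
  ultimately show ?thesis
    using mixing_coeff_upper[OF A(1) B(1)] W_shift[OF subset_insertI] W_shift[of "{j}"] W_shift[of "insert j J"] by auto
qed

text \<open>Induction splitting off the rightmost block; each separation costs one mixing
  coefficient.\<close>

lemma sup_events_almost_product:
  assumes N: "resolves N \<phi> \<psi>"
    and ab: "\<And>i. i < n \<Longrightarrow> a i \<le> b i"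
    and gap: "\<And>i j. i < j \<Longrightarrow> j < n \<Longrightarrow> b i + t \<le> a j"
    and C: "\<And>i. C i \<in> sets borel"
  shows "\<bar>prob {\<omega> \<in> space M. \<forall>i<n. max \<psi> (S (a i) (b i) \<omega>) \<in> C i} -
    (\<Prod>i<n. prob {\<omega> \<in> space M. max \<psi> (S (a i) (b i) \<omega>) \<in> C i})\<bar> \<le> real n * mixing_coeff \<phi> t"
  using ab gap
proof (induction n)
  case 0
  show ?case by (simp add: prob_space)
next
  case (Suc n)
  let ?P = "\<lambda>i. prob {\<omega> \<in> space M. max \<psi> (S (a i) (b i) \<omega>) \<in> C i}"
  let ?A = "prob {\<omega> \<in> space M. \<forall>i<n. max \<psi> (S (a i) (b i) \<omega>) \<in> C i}"
  let ?AB = "prob {\<omega> \<in> space M. \<forall>i<Suc n. max \<psi> (S (a i) (b i) \<omega>) \<in> C i}"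
  have "\<bar>?AB - ?A * ?P n\<bar> \<le> mixing_coeff \<phi> t"
    using sup_events_almost_independent[OF N, of "{..<n}" n a b t C] Suc.prems C
    by (simp only: lessThan_Suc[symmetric] Ball_def lessThan_iff finite_lessThan)
  moreover have "\<bar>?A * ?P n - (\<Prod>i<Suc n. ?P i)\<bar> \<le> real n * mixing_coeff \<phi> t"
  proof -
    have "\<bar>?A * ?P n - (\<Prod>i<Suc n. ?P i)\<bar> = \<bar>?A - (\<Prod>i<n. ?P i)\<bar> * ?P n"
      by (simp add: abs_mult flip: left_diff_distrib)
    also have "\<dots> \<le> \<bar>?A - (\<Prod>i<n. ?P i)\<bar> * 1" by (intro mult_left_mono) auto
    also have "\<dots> \<le> real n * mixing_coeff \<phi> t" using Suc by simp
    finally show ?thesis .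
  qed
  ultimately have "\<bar>?AB - (\<Prod>i<Suc n. ?P i)\<bar> \<le> mixing_coeff \<phi> t + real n * mixing_coeff \<phi> t" by linarith
  then show ?case by (simp add: algebra_simps)
qed

lemma sup_atom_le:
  "prob {\<omega> \<in> space M. S 0 T \<omega> = x} \<le> (SUP x. prob {\<omega> \<in> space M. S 0 T \<omega> = x})"
  by (rule cSUP_upper) (auto intro: bdd_aboveI2[of _ _ 1])

lemma mixing_coeff_nonneg: "0 \<le> mixing_coeff u t"
  using mixing_coeff_upper[of "{}" u "{}" t] by (simp add: generated_events_def sigma_sets.Empty)

text \<open>The event that the process ever becomes positive has probability \<open>0\<close> or \<open>1\<close>: whenever
  \<open>\<phi> t \<le> 0\<close>, truncation retains its restrictions to the past and to the future, and whenever
  \<open>\<phi> t > 0\<close>, it is implied by an event of probability close to \<open>1\<close>.\<close>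

lemma ever_positive_zero_one:
  assumes \<beta>: "((\<lambda>t. prob {\<omega> \<in> space M. S 0 t \<omega> < \<phi> t}) \<longlongrightarrow> 0) at_top"
    and \<alpha>: "((\<lambda>t. mixing_coeff (\<phi> t) t) \<longlongrightarrow> 0) at_top"
  shows "((\<lambda>T. prob {\<omega> \<in> space M. S 0 T \<omega> \<le> 0}) \<longlongrightarrow> 0) at_top \<or>
    (\<forall>T\<ge>0. prob {\<omega> \<in> space M. 0 < S 0 T \<omega>} = 0)"
proof -
  define pos where "pos = (\<lambda>T. prob {\<omega> \<in> space M. 0 < S 0 T \<omega>})"
  \<comment> \<open>The probability of ever becoming positive on the half-line, as a limit of the
    increasing \<open>pos T\<close>.\<close>
  define q where "q = (SUP T\<in>{0..}. pos T)"
  have sets: "{\<omega> \<in> space M. 0 < S a b \<omega>} \<in> sets M" if "a \<le> b" for a b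
    using S_measurable[OF that] by measurable
  have mono: "pos T \<le> pos T'" if "0 \<le> T" "T \<le> T'" for T T'
    unfolding pos_def using that S_mono[of _ 0 0 T T']
    by (intro finite_measure_mono sets) (auto intro: less_le_trans)
  have bdd: "bdd_above (pos ` {0..})" by (intro bdd_aboveI2[of _ _ 1]) (simp add: pos_def)
  have pos_q: "pos T \<le> q" if "0 \<le> T" for T unfolding q_def using that bdd by (intro cSUP_upper) auto
  have "0 \<le> pos 0" by (simp add: pos_def)
  then have "0 \<le> q" using pos_q[of 0] by simp
  moreover have "q \<le> 1" unfolding q_def by (rule cSUP_least) (auto simp: pos_def)
  ultimately have q01: "0 \<le> q" "q \<le> 1" by auto
  \<comment> \<open>In the limit this gives \<open>q \<le> q * q\<close>, which forces
    \<open>q\<close> to be \<open>0\<close> or \<open>1\<close>.\<close>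
  have step: "q \<le> q * q + (prob {\<omega> \<in> space M. S 0 t \<omega> < \<phi> t} + 2 * mixing_coeff (\<phi> t) t)" if t: "0 < t" for t
  proof (cases "\<phi> t \<le> 0")
    case True
    then have N: "resolves {} (\<phi> t) 0" using resolves_nonneg[of "\<phi> t"] by (simp add: max_def)
    have "pos T \<le> (q + q * q + 2 * mixing_coeff (\<phi> t) t) / 2" if T: "0 \<le> T" for T
    proof -
      \<comment> \<open>Two copies of \<open>[0, T]\<close> at distance \<open>t\<close>. Their
        union has probability at most \<open>q\<close>, while inclusion-exclusion and near
        independence make it at least \<open>2 * pos T - q * q\<close> up to the mixing
        error.\<close>
      define a where "a = (\<lambda>i::nat. real i * (T + t))"
      let ?E = "\<lambda>i. {\<omega> \<in> space M. 0 < S (a i) (a i + T) \<omega>}"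
      have E_sets: "?E i \<in> sets M" for i using T by (intro sets) simp
      have E_prob: "prob (?E i) = pos T" for i
        using sup_event_shift[of 0 T "{0<..}" "a i"] T by (simp add: pos_def add.commute)
      have "\<bar>prob {\<omega> \<in> space M. \<forall>i<2. max 0 (S (a i) (a i + T) \<omega>) \<in> {0<..}} -
          (\<Prod>i<2. prob {\<omega> \<in> space M. max 0 (S (a i) (a i + T) \<omega>) \<in> {0<..}})\<bar> \<le> real 2 * mixing_coeff (\<phi> t) t"
      proof (rule sup_events_almost_product[OF N])
        fix i j :: nat assume "i < j" "j < 2"
        then have "i = 0" "j = 1" by auto
        then show "a i + T + t \<le> a j" by (simp add: a_def)
      qed (use T in auto)
      moreover have "{\<omega> \<in> space M. \<forall>i<2. max 0 (S (a i) (a i + T) \<omega>) \<in> {0<..}} = ?E 0 \<inter> ?E 1"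
        by (auto simp: less_2_cases_iff)
      moreover have "{\<omega> \<in> space M. max 0 (S (a i) (a i + T) \<omega>) \<in> {0<..}} = ?E i" for i by auto
      ultimately have "prob (?E 0 \<inter> ?E 1) \<le> pos T * pos T + 2 * mixing_coeff (\<phi> t) t"
        by (simp add: E_prob numeral_2_eq_2 abs_le_iff)
      moreover have "pos T * pos T \<le> q * q"
        using pos_q[OF T] q01 by (intro mult_mono) (auto simp: pos_def)
      moreover have "prob (?E 0 \<union> ?E 1) = prob (?E 0) + prob (?E 1) - prob (?E 0 \<inter> ?E 1)"
        using E_sets by (intro measure_Un3) (auto simp: fmeasurable_eq_sets)
      moreover have "prob (?E 0 \<union> ?E 1) \<le> pos (2 * T + t)"
        unfolding pos_def
      proof (rule finite_measure_mono)
        show "?E 0 \<union> ?E 1 \<subseteq> {\<omega> \<in> space M. 0 < S 0 (2 * T + t) \<omega>}"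
          using S_mono[of _ 0 "a 0" "a 0 + T" "2 * T + t"] S_mono[of _ 0 "a 1" "a 1 + T" "2 * T + t"] T t
          by (auto simp: a_def intro: less_le_trans)
      qed (use sets T t in auto)
      moreover have "pos (2 * T + t) \<le> q" using T t by (intro pos_q) auto
      ultimately show ?thesis by (simp add: E_prob)
    qed
    then have "(SUP T\<in>{0..}. pos T) \<le> (q + q * q + 2 * mixing_coeff (\<phi> t) t) / 2" by (intro cSUP_least) auto
    then have "q \<le> q * q + 2 * mixing_coeff (\<phi> t) t" unfolding q_def[symmetric] by simp
    also have "\<dots> \<le> q * q + (prob {\<omega> \<in> space M. S 0 t \<omega> < \<phi> t} + 2 * mixing_coeff (\<phi> t) t)" by simp
    finally show ?thesis .
  next
    case False
    have "1 - prob {\<omega> \<in> space M. S 0 t \<omega> < \<phi> t} = prob {\<omega> \<in> space M. \<not> S 0 t \<omega> < \<phi> t}"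
      using S_measurable[of 0 t] t by (intro prob_neg[symmetric]) simp
    also have "\<dots> \<le> pos t"
      unfolding pos_def using False t by (intro finite_measure_mono sets) auto
    also have "pos t \<le> q" using t by (intro pos_q) simp
    finally have "1 - q \<le> prob {\<omega> \<in> space M. S 0 t \<omega> < \<phi> t}" by simp
    moreover have "q * (1 - q) \<le> 1 * (1 - q)" using q01 by (intro mult_right_mono) auto
    ultimately show ?thesis using mixing_coeff_nonneg[of "\<phi> t" t] by (simp add: algebra_simps)
  qed
  have "((\<lambda>t. q * q + (prob {\<omega> \<in> space M. S 0 t \<omega> < \<phi> t} + 2 * mixing_coeff (\<phi> t) t)) \<longlongrightarrow> q * q + (0 + 2 * 0)) at_top"
    by (intro tendsto_intros \<alpha> \<beta>)
  then have "q \<le> q * q + (0 + 2 * 0)"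
    by (rule tendsto_lowerbound) (use step in \<open>auto intro: eventually_mono[OF eventually_gt_at_top[of 0]]\<close>)
  then have "q * (1 - q) \<le> 0" by (simp add: algebra_simps)
  then consider "q = 0" | "q = 1" using q01 by (force simp: mult_le_0_iff)
  then show ?thesis
  proof cases
    case 1
    then have "pos T = 0" if "0 \<le> T" for T using pos_q[OF that] by (simp add: pos_def measure_le_0_iff)
    then show ?thesis by (simp add: pos_def)
  next
    case 2
    have "((\<lambda>T. 1 - pos T) \<longlongrightarrow> 0) at_top"
    proof (rule tendstoI)
      fix e :: real assume "0 < e"
      then have "1 - e < (SUP T\<in>{0..}. pos T)" using 2 by (simp add: q_def)
      then obtain T0 where T0: "0 \<le> T0" "1 - e < pos T0"
        using less_cSUP_iff[OF _ bdd] by auto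
      show "\<forall>\<^sub>F T in at_top. dist (1 - pos T) 0 < e"
        using eventually_ge_at_top[of T0]
      proof eventually_elim
        case (elim T)
        then show ?case using mono[OF T0(1) elim] T0 pos_q[of T] q01 by simp
      qed
    qed
    then have "((\<lambda>T. prob {\<omega> \<in> space M. S 0 T \<omega> \<le> 0}) \<longlongrightarrow> 0) at_top"
    proof (rule Lim_transform_eventually)
      show "\<forall>\<^sub>F T in at_top. 1 - pos T = prob {\<omega> \<in> space M. S 0 T \<omega> \<le> 0}"
        using eventually_ge_at_top[of 0]
      proof eventually_elim
        case (elim T)
        then show ?case
          unfolding pos_def not_less[symmetric] using sets[OF elim] by (intro prob_neg[symmetric]) simp
      qed
    qed
    then show ?thesis ..
  qed
qed

text \<open>Replaces the levels of TailSM by levels \<open>\<psi>\<close> above which truncation is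
  harmless, while the supremum still exceeds them with probability tending to
  \<open>1\<close>.\<close>

lemma tail_levels:
  assumes "TailSM M X" and "assumption_A M X"
  obtains N \<phi> \<psi> where "\<And>t. resolves N (\<phi> t) (\<psi> t)"
    and "((\<lambda>t. prob {\<omega> \<in> space M. S 0 t \<omega> < \<psi> t}) \<longlongrightarrow> 0) at_top"
    and "((\<lambda>t. mixing_coeff (\<phi> t) t) \<longlongrightarrow> 0) at_top"
proof -
  obtain \<phi> where \<phi>: "((\<lambda>t. prob {\<omega> \<in> space M. S 0 t \<omega> \<ge> \<phi> t}) \<longlongrightarrow> 1) at_top"
    and \<alpha>: "((\<lambda>t. mixing_coeff (\<phi> t) t) \<longlongrightarrow> 0) at_top"
    using assms(1) unfolding TailSM_def path_sup_eq mixing_coeff_def by blast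
  have S_sets: "{\<omega> \<in> space M. S 0 t \<omega> < c} \<in> sets M" "{\<omega> \<in> space M. S 0 t \<omega> \<le> c} \<in> sets M"
    "{\<omega> \<in> space M. c \<le> S 0 t \<omega>} \<in> sets M" "{\<omega> \<in> space M. S 0 t \<omega> = c} \<in> sets M" if "0 \<le> t" for t c
    using S_measurable[OF that] by measurable
  have "((\<lambda>t. 1 - prob {\<omega> \<in> space M. S 0 t \<omega> \<ge> \<phi> t}) \<longlongrightarrow> 0) at_top"
    using tendsto_diff[OF tendsto_const[of 1] \<phi>] by simp
  then have \<beta>: "((\<lambda>t. prob {\<omega> \<in> space M. S 0 t \<omega> < \<phi> t}) \<longlongrightarrow> 0) at_top"
  proof (rule Lim_transform_eventually)
    show "\<forall>\<^sub>F t in at_top. 1 - prob {\<omega> \<in> space M. S 0 t \<omega> \<ge> \<phi> t} = prob {\<omega> \<in> space M. S 0 t \<omega> < \<phi> t}"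
      using eventually_ge_at_top[of 0]
    proof eventually_elim
      case (elim t)
      then show ?case unfolding not_le[symmetric] using S_sets[OF elim] by (intro prob_neg[symmetric]) simp
    qed
  qed
  from ever_positive_zero_one[OF \<beta> \<alpha>] show ?thesis
  proof
    assume pos: "((\<lambda>T. prob {\<omega> \<in> space M. S 0 T \<omega> \<le> 0}) \<longlongrightarrow> 0) at_top"
    have "((\<lambda>t. prob {\<omega> \<in> space M. S 0 t \<omega> < max (\<phi> t) 0}) \<longlongrightarrow> 0) at_top"
    proof (rule tendsto_sandwich[OF _ _ tendsto_const])
      show "((\<lambda>t. prob {\<omega> \<in> space M. S 0 t \<omega> < \<phi> t} + prob {\<omega> \<in> space M. S 0 t \<omega> \<le> 0}) \<longlongrightarrow> 0) at_top"
        using tendsto_add[OF \<beta> pos] by simp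
      show "\<forall>\<^sub>F t in at_top. prob {\<omega> \<in> space M. S 0 t \<omega> < max (\<phi> t) 0} \<le>
          prob {\<omega> \<in> space M. S 0 t \<omega> < \<phi> t} + prob {\<omega> \<in> space M. S 0 t \<omega> \<le> 0}"
        using eventually_ge_at_top[of 0]
      proof eventually_elim
        case (elim t)
        have "prob {\<omega> \<in> space M. S 0 t \<omega> < max (\<phi> t) 0} \<le>
            prob ({\<omega> \<in> space M. S 0 t \<omega> < \<phi> t} \<union> {\<omega> \<in> space M. S 0 t \<omega> \<le> 0})"
          using S_sets[OF elim] by (intro finite_measure_mono) auto
        also have "\<dots> \<le> prob {\<omega> \<in> space M. S 0 t \<omega> < \<phi> t} + prob {\<omega> \<in> space M. S 0 t \<omega> \<le> 0}"
          using S_sets[OF elim] by (intro measure_Un_le) auto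
        finally show ?case .
      qed
    qed simp
    then show ?thesis using that[of "{}" \<phi> "\<lambda>t. max (\<phi> t) 0"] resolves_nonneg \<alpha> by blast
  next
    assume zero: "\<forall>T\<ge>0. prob {\<omega> \<in> space M. 0 < S 0 T \<omega>} = 0"
    \<comment> \<open>Since positive values have probability \<open>0\<close>, a nonnegative
      supremum over \<open>[0, T]\<close> forces the supremum over every longer horizon
      \<open>T'\<close> to equal \<open>0\<close> almost surely. Assumption A makes this atom vanish
      as \<open>T'\<close> grows.\<close>
    have nonneg0: "prob {\<omega> \<in> space M. 0 \<le> S 0 T \<omega>} = 0" if T: "0 \<le> T" for T
    proof -
      have "prob {\<omega> \<in> space M. 0 \<le> S 0 T \<omega>} \<le> (SUP x. prob {\<omega> \<in> space M. S 0 T' \<omega> = x})" if T': "T \<le> T'" for T'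
      proof -
        have T'0: "0 \<le> T'" using T T' by simp
        have "{\<omega> \<in> space M. 0 < S 0 T' \<omega>} \<in> sets M" using S_measurable[OF T'0] by measurable
        have "prob {\<omega> \<in> space M. 0 \<le> S 0 T \<omega>} \<le> prob ({\<omega> \<in> space M. 0 < S 0 T' \<omega>} \<union> {\<omega> \<in> space M. S 0 T' \<omega> = 0})"
          using S_sets[OF T'0] S_mono[of _ 0 0 T T'] T T' \<open>{\<omega> \<in> space M. 0 < S 0 T' \<omega>} \<in> sets M\<close>
          by (intro finite_measure_mono) force+
        also have "\<dots> \<le> prob {\<omega> \<in> space M. 0 < S 0 T' \<omega>} + prob {\<omega> \<in> space M. S 0 T' \<omega> = 0}"
          using S_sets[OF T'0] \<open>{\<omega> \<in> space M. 0 < S 0 T' \<omega>} \<in> sets M\<close> by (intro measure_Un_le) auto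
        finally show ?thesis using zero T'0 sup_atom_le[of T' 0] by simp
      qed
      then have "prob {\<omega> \<in> space M. 0 \<le> S 0 T \<omega>} \<le> 0"
        using assms(2) unfolding assumption_A_def path_sup_eq
        by (intro tendsto_lowerbound[of _ 0 at_top]) (auto intro: eventually_mono[OF eventually_ge_at_top[of T]])
      then show ?thesis by (simp add: measure_le_0_iff)
    qed
    \<comment> \<open>Symmetric intervals exhaust the line, so a single null set serves all times,
      negative ones included.\<close>
    define N where "N = (\<Union>n::nat. {\<omega> \<in> space M. 0 \<le> S (- real n) (real n) \<omega>})"
    have "{\<omega> \<in> space M. 0 \<le> S (- real n) (real n) \<omega>} \<in> null_sets M" for n
    proof -
      have "prob {\<omega> \<in> space M. 0 \<le> S (- real n) (real n) \<omega>} = 0"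
        using sup_event_shift[of 0 "2 * real n" "{0..}" "- real n"] nonneg0[of "2 * real n"] by simp
      moreover have "{\<omega> \<in> space M. 0 \<le> S (- real n) (real n) \<omega>} \<in> sets M"
        using S_measurable[of "- real n" "real n"] by measurable
      ultimately show ?thesis by (simp add: null_sets_def emeasure_eq_measure)
    qed
    then have "N \<in> null_sets M" unfolding N_def by (rule null_sets_UN)
    moreover have "X s \<omega> < 0" if \<omega>: "\<omega> \<in> space M - N" for \<omega> s
    proof -
      obtain n :: nat where "\<bar>s\<bar> \<le> real n" using real_arch_simple by blast
      then have "X s \<omega> \<le> S (- real n) (real n) \<omega>" using \<omega> by (intro S_upper) auto
      moreover have "S (- real n) (real n) \<omega> < 0" using \<omega> by (auto simp: N_def not_le)
      ultimately show ?thesis by simp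
    qed
    ultimately have "resolves N (\<phi> t) (\<phi> t)" for t by (rule resolves_neg)
    then show ?thesis using that \<alpha> \<beta> by blast
  qed
qed

section \<open>Convergence of the location\<close>

text \<open>Block suprema are raised to at least \<open>\<psi> h\<close>, which makes them visible
  to the truncated process. Near independence and small atoms then feed the strict argmax
  estimate.\<close>

lemma block_argmax_prob:
  assumes tail: "TailSM M X" and A: "assumption_A M X"
    and n: "0 < n" and m: "0 < m" and \<delta>: "0 < \<delta>"
  shows "\<forall>\<^sub>F h in at_top. \<forall>i<n. 1 / real n - \<delta> \<le>
    prob {\<omega> \<in> space M. \<forall>j<n. j \<noteq> i \<longrightarrow>
      S (real j * ((real m + 1) * h)) (real j * ((real m + 1) * h) + real m * h) \<omega> <
      S (real i * ((real m + 1) * h)) (real i * ((real m + 1) * h) + real m * h) \<omega>}"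
proof -
  obtain N \<phi> \<psi> where N: "\<And>t. resolves N (\<phi> t) (\<psi> t)"
    and \<beta>: "((\<lambda>t. prob {\<omega> \<in> space M. S 0 t \<omega> < \<psi> t}) \<longlongrightarrow> 0) at_top"
    and \<alpha>: "((\<lambda>t. mixing_coeff (\<phi> t) t) \<longlongrightarrow> 0) at_top"
    using tail_levels[OF tail A] by blast
  define atom where "atom = (\<lambda>T. SUP x. prob {\<omega> \<in> space M. S 0 T \<omega> = x})"
  have atom0: "(atom \<longlongrightarrow> 0) at_top" using A unfolding assumption_A_def path_sup_eq atom_def .
  have mh: "filterlim (\<lambda>h. real m * h) at_top at_top"
    by (rule filterlim_tendsto_pos_mult_at_top[OF tendsto_const _ filterlim_ident]) (use m in simp)
  \<comment> \<open>The cell count \<open>K\<close> is fixed first, to make \<open>n / K\<close>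
    small; all other terms of \<open>err\<close> vanish as \<open>h\<close> grows.\<close>
  obtain K :: nat where K: "0 < K" "real n / real K < \<delta>"
  proof -
    obtain K :: nat where K: "real n / \<delta> < real K" using reals_Archimedean2 by blast
    moreover have "0 < real n / \<delta>" using n \<delta> by simp
    ultimately have "0 < real K" by linarith
    then show ?thesis using K \<delta> by (intro that[of K]) (auto simp: field_simps)
  qed
  define err where "err = (\<lambda>h. real n * (1 / real K + (prob {\<omega> \<in> space M. S 0 h \<omega> < \<psi> h} + atom (real m * h))) +
    (real n + 2) * (real K + 1) * (real n * mixing_coeff (\<phi> h) h))"
  have "(err \<longlongrightarrow> real n * (1 / real K + (0 + 0)) + (real n + 2) * (real K + 1) * (real n * 0)) at_top"
    unfolding err_def by (intro tendsto_intros \<alpha> \<beta> filterlim_compose[OF atom0 mh])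
  then have "\<forall>\<^sub>F h in at_top. err h < \<delta>" using K by (intro order_tendstoD) auto
  then show ?thesis
    using eventually_gt_at_top[of 0]
  proof eventually_elim
    case (elim h)
    define a where "a = (\<lambda>i::nat. real i * ((real m + 1) * h))"
    define W where "W = (\<lambda>i. S (a i) (a i + real m * h))"
    define V where "V = (\<lambda>i \<omega>. max (\<psi> h) (W i \<omega>))"
    have mh0: "0 \<le> real m * h" "h \<le> real m * h" using elim m by auto
    have W[measurable]: "W i \<in> borel_measurable M" for i
      unfolding W_def using mh0 by (intro S_measurable) auto
    have V: "V i \<in> borel_measurable M" for i unfolding V_def by measurable
    have W0: "W 0 = S 0 (real m * h)" by (simp add: W_def a_def)
    have V_shift: "prob {\<omega> \<in> space M. V i \<omega> \<in> C} = prob {\<omega> \<in> space M. V 0 \<omega> \<in> C}" if C: "C \<in> sets borel" for i C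
    proof -
      have "max (\<psi> h) -` C \<in> sets borel"
        using measurable_sets[of "max (\<psi> h)" borel borel C] C by simp
      from sup_event_shift[OF mh0(1) this, of "a i"] show ?thesis
        by (simp add: V_def W0) (simp add: W_def add.commute)
    qed
    show ?case
    proof (intro allI impI)
      fix i assume i: "i < n"
      have "1 / real n - err h \<le> prob {\<omega> \<in> space M. \<forall>j<n. j \<noteq> i \<longrightarrow> V j \<omega> < V i \<omega>}"
        unfolding err_def
      proof (rule strict_argmax_prob_ge[OF V _ _ K(1) i])
        fix C :: "nat \<Rightarrow> real set" assume C: "\<And>i. C i \<in> sets borel"
        have "\<bar>prob {\<omega> \<in> space M. \<forall>i<n. V i \<omega> \<in> C i} -
            (\<Prod>i<n. prob {\<omega> \<in> space M. V i \<omega> \<in> C i})\<bar> \<le> real n * mixing_coeff (\<phi> h) h"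
          unfolding V_def W_def
        proof (rule sup_events_almost_product[OF N _ _ C])
          fix j k :: nat assume "j < k"
          then have "(real j + 1) * ((real m + 1) * h) \<le> real k * ((real m + 1) * h)"
            using elim by (intro mult_right_mono) auto
          then show "a j + real m * h + h \<le> a k" by (simp add: a_def algebra_simps)
        qed (use mh0 in auto)
        also have "(\<Prod>i<n. prob {\<omega> \<in> space M. V i \<omega> \<in> C i}) = (\<Prod>i<n. prob {\<omega> \<in> space M. V 0 \<omega> \<in> C i})"
          using V_shift[OF C] by (intro prod.cong) auto
        finally show "\<bar>prob {\<omega> \<in> space M. \<forall>i<n. V i \<omega> \<in> C i} -
            (\<Prod>i<n. prob {\<omega> \<in> space M. V 0 \<omega> \<in> C i})\<bar> \<le> real n * mixing_coeff (\<phi> h) h" .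
      next
        fix x
        \<comment> \<open>An atom of \<open>V 0\<close> is an atom of the block supremum unless the
          floor \<open>\<psi> h\<close> is active. The latter needs \<open>S 0 h\<close> to be below
          \<open>\<psi> h\<close>, since the block contains \<open>[0, h]\<close>.\<close>
        have "prob {\<omega> \<in> space M. V 0 \<omega> = x} \<le>
            prob ({\<omega> \<in> space M. S 0 h \<omega> < \<psi> h} \<union> {\<omega> \<in> space M. S 0 (real m * h) \<omega> = x})"
        proof (rule finite_measure_mono)
          show "{\<omega> \<in> space M. V 0 \<omega> = x} \<subseteq> {\<omega> \<in> space M. S 0 h \<omega> < \<psi> h} \<union> {\<omega> \<in> space M. S 0 (real m * h) \<omega> = x}"
          proof
            fix \<omega> assume \<omega>: "\<omega> \<in> {\<omega> \<in> space M. V 0 \<omega> = x}"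
            then have "S 0 h \<omega> \<le> S 0 (real m * h) \<omega>" using mh0 elim by (intro S_mono) auto
            then show "\<omega> \<in> {\<omega> \<in> space M. S 0 h \<omega> < \<psi> h} \<union> {\<omega> \<in> space M. S 0 (real m * h) \<omega> = x}"
              using \<omega> by (auto simp: V_def W0 max_def split: if_splits)
          qed
          show "{\<omega> \<in> space M. S 0 h \<omega> < \<psi> h} \<union> {\<omega> \<in> space M. S 0 (real m * h) \<omega> = x} \<in> sets M"
            using S_measurable[of 0 h] S_measurable[of 0 "real m * h"] mh0 elim by simp
        qed
        also have "\<dots> \<le> prob {\<omega> \<in> space M. S 0 h \<omega> < \<psi> h} + prob {\<omega> \<in> space M. S 0 (real m * h) \<omega> = x}"
          using S_measurable[of 0 h] S_measurable[of 0 "real m * h"] mh0 elim by (intro measure_Un_le) simp_all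
        also have "prob {\<omega> \<in> space M. S 0 (real m * h) \<omega> = x} \<le> atom (real m * h)"
          unfolding atom_def by (rule sup_atom_le)
        finally show "prob {\<omega> \<in> space M. V 0 \<omega> = x} \<le> prob {\<omega> \<in> space M. S 0 h \<omega> < \<psi> h} + atom (real m * h)"
          by simp
      qed
      \<comment> \<open>A strict maximum of the \<open>V\<close> lies above the floor, where
        \<open>V i\<close> and \<open>W i\<close> agree, and \<open>W j \<le> V j\<close> for the
        others.\<close>
      also have "{\<omega> \<in> space M. \<forall>j<n. j \<noteq> i \<longrightarrow> V j \<omega> < V i \<omega>} \<subseteq> {\<omega> \<in> space M. \<forall>j<n. j \<noteq> i \<longrightarrow> W j \<omega> < W i \<omega>}"
        by (auto simp: V_def max_def split: if_splits)
      then have "prob {\<omega> \<in> space M. \<forall>j<n. j \<noteq> i \<longrightarrow> V j \<omega> < V i \<omega>} \<le>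
          prob {\<omega> \<in> space M. \<forall>j<n. j \<noteq> i \<longrightarrow> W j \<omega> < W i \<omega>}"
      proof (rule finite_measure_mono)
        have "{\<omega> \<in> space M. \<forall>j\<in>{..<n}. j \<noteq> i \<longrightarrow> W j \<omega> < W i \<omega>} \<in> sets M"
          by (intro sets.sets_Collect_finite_All) auto
        then show "{\<omega> \<in> space M. \<forall>j<n. j \<noteq> i \<longrightarrow> W j \<omega> < W i \<omega>} \<in> sets M"
          unfolding Ball_def lessThan_iff .
      qed
      finally show "1 / real n - \<delta> \<le>
        prob {\<omega> \<in> space M. \<forall>j<n. j \<noteq> i \<longrightarrow>
          S (real j * ((real m + 1) * h)) (real j * ((real m + 1) * h) + real m * h) \<omega> <
          S (real i * ((real m + 1) * h)) (real i * ((real m + 1) * h) + real m * h) \<omega>}"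
        using elim(1) by (simp add: W_def a_def)
    qed
  qed
qed

text \<open>The horizon \<open>T\<close> is made up of \<open>n\<close> blocks of length \<open>m h\<close> and \<open>n - 1\<close> gaps of length \<open>h\<close>;
  \<open>P i\<close> is the event that block \<open>i\<close> has the largest supremum.\<close>

lemma block_location_prob_ge:
  fixes n m :: nat and h :: real
  defines "a \<equiv> \<lambda>i::nat. real i * ((real m + 1) * h)"
  defines "P \<equiv> \<lambda>i. {\<omega> \<in> space M. \<forall>j<n. j \<noteq> i \<longrightarrow> S (a j) (a j + real m * h) \<omega> < S (a i) (a i + real m * h) \<omega>}"
  assumes n: "0 < n" and m: "0 < m" and h: "0 < h"
    and p: "\<And>i. i < n \<Longrightarrow> p \<le> prob (P i)"
    and T: "T = (real n * (real m + 1) - 1) * h" and I: "I \<subseteq> {..<n}"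
    and E: "E \<in> sets M" "\<And>i \<omega>. i \<in> I \<Longrightarrow> \<omega> \<in> space M \<Longrightarrow> a i \<le> sup_loc X T \<omega> \<Longrightarrow>
      sup_loc X T \<omega> \<le> a i + real m * h \<Longrightarrow> \<omega> \<in> E"
  shows "real (card I) * p - real n / real m \<le> prob E"
proof -
  have mh0: "0 \<le> real m * h" using h by simp
  have a_Suc: "a (Suc i) = a i + real m * h + h" for i by (simp add: a_def algebra_simps)
  have a_mono: "a i \<le> a j" if "i \<le> j" for i j
    unfolding a_def using that h by (intro mult_right_mono) auto
  have a_n: "a n = T + h" by (simp add: a_def T algebra_simps)
  have T_eq: "T = a (n - 1) + real m * h" using a_Suc[of "n - 1"] a_n n by simp
  have a0: "0 \<le> a i" for i using h by (simp add: a_def)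
  have T0: "0 \<le> T" using T_eq a0[of "n - 1"] mh0 by simp
  note [measurable] = sup_loc_measurable[OF T0]
  have P_sets: "P i \<in> sets M" for i
  proof -
    have "{\<omega> \<in> space M. \<forall>j\<in>{..<n}. j \<noteq> i \<longrightarrow> S (a j) (a j + real m * h) \<omega> < S (a i) (a i + real m * h) \<omega>} \<in> sets M"
    proof (rule sets.sets_Collect_finite_All)
      fix j
      show "{\<omega> \<in> space M. j \<noteq> i \<longrightarrow> S (a j) (a j + real m * h) \<omega> < S (a i) (a i + real m * h) \<omega>} \<in> sets M"
        using borel_measurable_less[OF S_measurable[of "a j" "a j + real m * h"] S_measurable[of "a i" "a i + real m * h"]] mh0
        by (cases "j = i") simp_all
    qed simp
    then show ?thesis unfolding P_def Ball_def lessThan_iff .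
  qed
  define G where "G = (\<lambda>i. {\<omega> \<in> space M. a i + real m * h < sup_loc X T \<omega> \<and> sup_loc X T \<omega> \<le> a i + real m * h + h})"
  have G_sets: "G i \<in> sets M" for i unfolding G_def by measurable
  \<comment> \<open>There is room \<open>m h\<close> on both sides of the start of the gap: the
    preceding block on the left, the gap and the next block on the right.\<close>
  have G_prob: "prob (G i) \<le> 1 / real m" if i: "i < n - 1" for i
  proof -
    have "a (Suc i) \<le> a (n - 1)" using i by (intro a_mono) auto
    then have "a i + real m * h + real m * h \<le> T" using T_eq a_Suc[of i] h by linarith
    then have "loc_cdf T (a i + real m * h + h) - loc_cdf T (a i + real m * h) \<le> 1 / real m"
      using h m a0[of i] by (intro loc_cdf_gap) auto
    then show ?thesis using loc_cdf_diff[OF T0, of "a i + real m * h" "a i + real m * h + h"] h by (simp add: G_def)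
  qed
  have "prob (\<Union>i<n - 1. G i) \<le> (\<Sum>i<n - 1. prob (G i))"
    by (intro finite_measure_subadditive_finite) (auto intro: G_sets)
  also have "\<dots> \<le> (\<Sum>i<n - 1. 1 / real m)" by (intro sum_mono G_prob) auto
  also have "\<dots> \<le> real n / real m" by (simp add: divide_right_mono)
  finally have G_le: "prob (\<Union>i<n - 1. G i) \<le> real n / real m" .
  \<comment> \<open>On \<open>P i\<close> no block other than \<open>i\<close> can contain the
    location, so it lies in block \<open>i\<close> or in a gap.\<close>
  have "\<omega> \<in> E \<union> (\<Union>i<n - 1. G i)" if i: "i \<in> I" and \<omega>: "\<omega> \<in> P i" for i \<omega>
  proof -
    have \<omega>M: "\<omega> \<in> space M" using \<omega> by (simp add: P_def)
    define \<tau> where "\<tau> = sup_loc X T \<omega>"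
    note props = sup_loc_props[OF \<omega>M T0, folded \<tau>_def]
    define L where "L = (real m + 1) * h"
    have L: "0 < L" using h by (simp add: L_def add_pos_nonneg)
    have aL: "a i = real i * L" for i by (simp add: a_def L_def)
    define j where "j = nat \<lfloor>\<tau> / L\<rfloor>"
    have "0 \<le> \<tau> / L" using props(1) L by simp
    then have j: "real j \<le> \<tau> / L" "\<tau> / L < real j + 1" by (simp_all add: j_def of_nat_nat)
    have aj: "a j \<le> \<tau>" "\<tau> < a (Suc j)"
      using j L unfolding aL by (simp_all add: field_simps)
    have "a j < a n" using aj(1) props(1) a_n h by simp
    then have jn: "j < n" using a_mono[of n j] by (meson not_le)
    show ?thesis
    proof (cases "\<tau> \<le> a j + real m * h")
      case False
      then have "j \<noteq> n - 1" using props(1) T_eq by auto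
      then have "j < n - 1" using jn by simp
      moreover have "\<omega> \<in> G j" using False aj(2) a_Suc[of j] \<omega>M by (simp add: G_def \<tau>_def)
      ultimately show ?thesis by blast
    next
      case True
      have "j = i"
      proof (rule ccontr)
        assume "j \<noteq> i"
        then have "S (a j) (a j + real m * h) \<omega> < S (a i) (a i + real m * h) \<omega>" using \<omega> jn by (simp add: P_def)
        moreover have "S 0 T \<omega> \<le> S (a j) (a j + real m * h) \<omega>"
          using S_upper[OF \<omega>M, of \<tau> "a j" "a j + real m * h"] True aj props(2) by simp
        moreover have "a i \<le> a (n - 1)" using i I by (intro a_mono) auto
        then have "S (a i) (a i + real m * h) \<omega> \<le> S 0 T \<omega>"
          using a0[of i] mh0 T_eq by (intro S_mono[OF \<omega>M]) auto
        ultimately show False by simp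
      qed
      then show ?thesis using E(2)[OF i \<omega>M] aj True by (simp add: \<tau>_def)
    qed
  qed
  then have sub: "(\<Union>i\<in>I. P i) \<subseteq> E \<union> (\<Union>i<n - 1. G i)" by blast
  have finI: "finite I" using I finite_subset by blast
  have disj: "disjoint_family_on P I"
    unfolding disjoint_family_on_def
  proof (intro ballI impI)
    fix i j assume ij: "i \<in> I" "j \<in> I" "i \<noteq> j"
    then have "i < n" "j < n" using I by auto
    then have "S (a j) (a j + real m * h) \<omega> < S (a i) (a i + real m * h) \<omega>"
      "S (a i) (a i + real m * h) \<omega> < S (a j) (a j + real m * h) \<omega>" if "\<omega> \<in> P i \<inter> P j" for \<omega>
      using that ij(3) unfolding P_def by blast+
    then show "P i \<inter> P j = {}" by (meson equals0I less_asym)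
  qed
  have "real (card I) * p = (\<Sum>i\<in>I. p)" by simp
  also have "\<dots> \<le> (\<Sum>i\<in>I. prob (P i))" using I by (intro sum_mono p) auto
  also have "\<dots> = prob (\<Union>i\<in>I. P i)"
    using finI disj P_sets by (intro finite_measure_finite_Union[symmetric]) auto
  also have "\<dots> \<le> prob (E \<union> (\<Union>i<n - 1. G i))"
    using sub E(1) G_sets by (intro finite_measure_mono) auto
  also have "\<dots> \<le> prob E + prob (\<Union>i<n - 1. G i)" using E(1) G_sets by (intro measure_Un_le) auto
  finally show ?thesis using G_le by simp
qed

text \<open>The block estimate is used twice: the \<open>k\<close> blocks before the grid point
  bound the distribution function from below, the \<open>n - k\<close> blocks after it from
  above.\<close>

lemma loc_cdf_grid:
  assumes tail: "TailSM M X" and A: "assumption_A M X" and n: "0 < n" and \<delta>: "0 < \<delta>"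
  shows "\<forall>\<^sub>F T in at_top. \<forall>k\<in>{1..n}. \<bar>loc_cdf T (real k * T / real n) - real k / real n\<bar> \<le> \<delta>"
proof -
  obtain m :: nat where m: "0 < m" "real n / real m < \<delta> / 2"
  proof -
    obtain m :: nat where m: "2 * real n / \<delta> < real m" using reals_Archimedean2 by blast
    moreover have "0 < 2 * real n / \<delta>" using n \<delta> by simp
    ultimately have "0 < real m" by linarith
    then show ?thesis using m \<delta> by (intro that[of m]) (auto simp: field_simps)
  qed
  define c where "c = real n * (real m + 1) - 1"
  have "1 < 1 * (real m + 1)" using m(1) by simp
  also have "\<dots> \<le> real n * (real m + 1)" using n by (intro mult_right_mono) auto
  finally have c: "0 < c" by (simp add: c_def)
  \<comment> \<open>At most \<open>n\<close> blocks each lose \<open>\<eta>\<close>, in total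
    \<open>\<delta> / 2\<close>; the gaps take less than another
    \<open>\<delta> / 2\<close>.\<close>
  define \<eta> where "\<eta> = \<delta> / (2 * real n)"
  have \<eta>: "0 < \<eta>" using \<delta> n by (simp add: \<eta>_def)
  have lim: "filterlim (\<lambda>T. T / c) at_top at_top"
    using filterlim_tendsto_pos_mult_at_top[OF tendsto_const[of "1 / c"] _ filterlim_ident] c by simp
  show ?thesis
    using eventually_compose_filterlim[OF block_argmax_prob[OF tail A n m(1) \<eta>] lim] eventually_gt_at_top[of 0]
  proof eventually_elim
    case (elim T)
    define h where "h = T / c"
    have h: "0 < h" using elim c by (simp add: h_def)
    have T: "T = (real n * (real m + 1) - 1) * h" using c by (simp add: h_def c_def[symmetric])
    have T0: "0 \<le> T" using elim by simp
    note [measurable] = sup_loc_measurable[OF T0]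
    note aux = block_location_prob_ge[OF n m(1) h elim(1)[rule_format, folded h_def] T]
    \<comment> \<open>The grid point precedes the position \<open>k (m + 1) h\<close> by
      \<open>k h / n\<close>, which lies in \<open>(0, h]\<close> for
      \<open>1 \<le> k \<le> n\<close>. So it separates the blocks with index below \<open>k\<close>
      from the others.\<close>
    have Tn: "real k * T / real n = real k * ((real m + 1) * h) - real k * h / real n" for k
      using n by (simp add: T field_simps)
    show ?case
    proof
      fix k assume k: "k \<in> {1..n}"
      have kn: "real k * h / real n \<le> h" "0 < real k * h / real n" using k n h by (simp_all add: field_simps)
      have "real (card {..<k}) * (1 / real n - \<eta>) - real n / real m \<le>
          prob {\<omega> \<in> space M. sup_loc X T \<omega> \<le> real k * T / real n}"
      proof (rule aux)
        fix i \<omega> assume i: "i \<in> {..<k}" and \<omega>: "\<omega> \<in> space M"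
          "sup_loc X T \<omega> \<le> real i * ((real m + 1) * h) + real m * h"
        have "(real i + 1) * ((real m + 1) * h) \<le> real k * ((real m + 1) * h)"
          using i h by (intro mult_right_mono) auto
        then have "real i * ((real m + 1) * h) + real m * h \<le> real k * T / real n"
          unfolding Tn using kn by (simp add: algebra_simps)
        then show "\<omega> \<in> {\<omega> \<in> space M. sup_loc X T \<omega> \<le> real k * T / real n}" using \<omega> by simp
      qed (use k in auto)
      then have lower: "real k * (1 / real n - \<eta>) - real n / real m \<le> loc_cdf T (real k * T / real n)"
        by (simp add: loc_cdf_def)
      have "real (card {k..<n}) * (1 / real n - \<eta>) - real n / real m \<le>
          prob {\<omega> \<in> space M. \<not> sup_loc X T \<omega> \<le> real k * T / real n}"
      proof (rule aux)
        fix i \<omega> assume i: "i \<in> {k..<n}" and \<omega>: "\<omega> \<in> space M" "real i * ((real m + 1) * h) \<le> sup_loc X T \<omega>"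
        have "real k * ((real m + 1) * h) \<le> real i * ((real m + 1) * h)"
          using i h by (intro mult_right_mono) auto
        then have "real k * T / real n < sup_loc X T \<omega>"
          unfolding Tn using kn \<omega>(2) by linarith
        then show "\<omega> \<in> {\<omega> \<in> space M. \<not> sup_loc X T \<omega> \<le> real k * T / real n}" using \<omega> by simp
      qed (use k in auto)
      also have "prob {\<omega> \<in> space M. \<not> sup_loc X T \<omega> \<le> real k * T / real n} = 1 - loc_cdf T (real k * T / real n)"
        unfolding loc_cdf_def by (intro prob_neg) measurable
      finally have upper: "loc_cdf T (real k * T / real n) \<le> 1 - (real n - real k) * (1 / real n - \<eta>) + real n / real m"
        using k by (simp add: of_nat_diff)
      have "real n * \<eta> = \<delta> / 2" using n by (simp add: \<eta>_def)
      moreover have "real k * \<eta> \<le> real n * \<eta>" "(real n - real k) * \<eta> \<le> real n * \<eta>"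
        using k \<eta> by (auto intro!: mult_right_mono)
      moreover have "(real n - real k) * (1 / real n - \<eta>) = 1 - real k / real n - (real n - real k) * \<eta>"
        using n by (simp add: field_simps)
      moreover have "real k * (1 / real n - \<eta>) = real k / real n - real k * \<eta>" by (simp add: right_diff_distrib)
      ultimately show "\<bar>loc_cdf T (real k * T / real n) - real k / real n\<bar> \<le> \<delta>"
        using lower upper m(2) by linarith
    qed
  qed
qed

text \<open>Monotonicity interpolates between grid points: the mesh and the grid error each cost at
  most \<open>\<delta> / 2\<close>. At \<open>x = 0\<close> this also shows that a possible atom at
  \<open>0\<close> fades.\<close>

lemma loc_cdf_uniform:
  assumes tail: "TailSM M X" and A: "assumption_A M X" and \<delta>: "0 < \<delta>"
  shows "\<forall>\<^sub>F T in at_top. \<forall>x\<in>{0..1}. \<bar>loc_cdf T (x * T) - x\<bar> \<le> \<delta>"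
proof -
  obtain n :: nat where n: "0 < n" "1 / real n < \<delta> / 2"
  proof -
    obtain n :: nat where n: "2 / \<delta> < real n" using reals_Archimedean2 by blast
    moreover have "0 < 2 / \<delta>" using \<delta> by simp
    ultimately have "0 < real n" by linarith
    then show ?thesis using n \<delta> by (intro that[of n]) (auto simp: field_simps)
  qed
  have \<delta>2: "0 < \<delta> / 2" using \<delta> by simp
  show ?thesis
    using loc_cdf_grid[OF tail A n(1) \<delta>2] eventually_gt_at_top[of 0]
  proof eventually_elim
    case (elim T)
    show ?case
    proof
      fix x :: real assume x: "x \<in> {0..1}"
      define k where "k = nat \<lfloor>x * real n\<rfloor>"
      have "0 \<le> x * real n" using x by simp
      then have k: "real k \<le> x * real n" "x * real n < real k + 1" by (simp_all add: k_def of_nat_nat)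
      have "x * real n \<le> 1 * real n" using x by (intro mult_right_mono) auto
      then have "real k \<le> real n" using k by linarith
      then have kn: "k \<le> n" by simp
      have "x - \<delta> \<le> loc_cdf T (x * T)"
      \<comment> \<open>The grid estimate starts at \<open>k = 1\<close>. Before the first grid
        point \<open>x\<close> is below \<open>\<delta>\<close>, and nonnegativity is
        enough.\<close>
      proof (cases "k = 0")
        case True
        then have "x < 1 / real n" using k n by (simp add: field_simps)
        then show ?thesis using loc_cdf_nonneg[of T "x * T"] n \<delta> by linarith
      next
        case False
        have "real k * T \<le> x * real n * T" using k elim by (intro mult_right_mono) auto
        then have "loc_cdf T (real k * T / real n) \<le> loc_cdf T (x * T)"
          using elim n by (intro loc_cdf_mono) (auto simp: field_simps)
        moreover have "x \<le> (real k + 1) / real n" using k n by (simp add: pos_le_divide_eq)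
        then have "x - 1 / real n \<le> real k / real n" by (simp add: add_divide_distrib)
        moreover have "\<bar>loc_cdf T (real k * T / real n) - real k / real n\<bar> \<le> \<delta> / 2"
          using False kn elim(1) by simp
        ultimately show ?thesis using n by linarith
      qed
      moreover have "loc_cdf T (x * T) \<le> x + \<delta>"
      proof -
        \<comment> \<open>The next grid point, capped because \<open>x = 1\<close> gives
          \<open>k = n\<close>.\<close>
        define l where "l = min n (k + 1)"
        have l: "x * real n \<le> real l" "real l \<le> x * real n + 1" "l \<in> {1..n}"
          using k kn n \<open>x * real n \<le> 1 * real n\<close> by (auto simp: l_def min_def)
        have "x * real n * T \<le> real l * T" using l elim by (intro mult_right_mono) auto
        then have "loc_cdf T (x * T) \<le> loc_cdf T (real l * T / real n)"
          using elim n by (intro loc_cdf_mono) (auto simp: field_simps)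
        moreover have "real l / real n \<le> x + 1 / real n" using l n by (simp add: field_simps)
        moreover have "\<bar>loc_cdf T (real l * T / real n) - real l / real n\<bar> \<le> \<delta> / 2"
          using l elim(1) by simp
        ultimately show ?thesis using n by linarith
      qed
      ultimately show "\<bar>loc_cdf T (x * T) - x\<bar> \<le> \<delta>" by linarith
    qed
  qed
qed

end

section \<open>Uniform convergence of densities and weak convergence\<close>

lemma cdf_uniform_measure_unit: "cdf (uniform_measure lborel {0<..<1}) x = max 0 (min 1 x)"
proof -
  have "cdf (uniform_measure lborel {0<..<1}) x = measure lborel ({0<..<1} \<inter> {..x})"
    by (simp add: cdf_def measure_uniform_measure)
  also have "{0<..<1} \<inter> {..x} = (if x < 1 then {0<..x} else {0<..<1})" by auto
  finally show ?thesis by (cases "0 \<le> x") (auto simp: max_def)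
qed

context usc_process
begin

lemma density_uniform:
  assumes tail: "TailSM M X" and A: "assumption_A M X"
    and f: "\<And>T. 0 < T \<Longrightarrow> sup_loc_density M X T (f T)"
    and \<epsilon>: "0 < \<epsilon>" and e: "0 < e"
  shows "\<forall>\<^sub>F T in at_top. \<forall>t\<in>{\<epsilon>..1-\<epsilon>}. \<bar>T * f T (t * T) - 1\<bar> \<le> e"
proof -
  \<comment> \<open>The bound by \<open>\<epsilon>\<close> keeps the averaging windows inside their
    horizons; the bound by \<open>e / (2 + e)\<close> is equivalent to
    \<open>1 / (1 - \<eta>) \<le> 1 + e / 2\<close>.\<close>
  define \<eta> where "\<eta> = min \<epsilon> (e / (2 + e))"
  have "e / (2 + e) < 1" "e / (2 + e) \<le> e / 2" using e by (simp_all add: field_simps)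
  moreover have "0 < \<eta>" "\<eta> \<le> \<epsilon>" "\<eta> \<le> e / (2 + e)" using \<epsilon> e by (simp_all add: \<eta>_def)
  ultimately have \<eta>: "0 < \<eta>" "\<eta> < 1" "\<eta> \<le> \<epsilon>" "\<eta> \<le> e / 2" "\<eta> \<le> e / (2 + e)" by linarith+
  \<comment> \<open>Two errors \<open>\<delta>\<close> enter each increment; after division by
    \<open>\<eta>\<close> they amount to \<open>e / 2\<close>.\<close>
  define \<delta> where "\<delta> = \<eta> * e / 4"
  have \<delta>: "0 < \<delta>" using \<eta> e by (simp add: \<delta>_def)
  have lim: "filterlim (\<lambda>T. c * T) at_top at_top" if "0 < c" for c :: real
    by (rule filterlim_tendsto_pos_mult_at_top[OF tendsto_const that filterlim_ident])
  have unif: "\<forall>\<^sub>F T in at_top. \<forall>x\<in>{0..1}. \<bar>loc_cdf (c * T) (x * (c * T)) - x\<bar> \<le> \<delta>" if "0 < c" for c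
    using eventually_compose_filterlim[OF loc_cdf_uniform[OF tail A \<delta>] lim[OF that]] .
  have "0 < 1 - \<eta>" "0 < 1 + \<eta>" using \<eta> by auto
  from unif[OF this(1)] unif[OF this(2)] show ?thesis
    using eventually_gt_at_top[of 0]
  proof eventually_elim
    case (elim T)
    note T = \<open>0 < T\<close>
    show ?case
    proof
      fix s assume s: "s \<in> {\<epsilon>..1-\<epsilon>}"
      have s01: "0 < s" "s < 1" using s \<epsilon> by auto
      have t: "0 < s * T" "s * T < T" using s01 T by auto
      have H: "0 < \<eta> * T" using \<eta> T by simp
      have upper: "T * f T (s * T) \<le> 1 + e"
      proof -
        define T' where "T' = (1 - \<eta>) * T"
        \<comment> \<open>The ends of the averaging window as fractions of the horizon
          \<open>T'\<close>; their distance is slightly more than \<open>\<eta>\<close>.\<close>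
        define x where "x = s / (1 - \<eta>)"
        define y where "y = (s - \<eta>) / (1 - \<eta>)"
        have x: "x \<in> {0..1}" "y \<in> {0..1}" using s \<eta> s01 by (auto simp: x_def y_def)
        have eq: "x * T' = s * T" "y * T' = s * T - \<eta> * T"
          unfolding x_def y_def T'_def left_diff_distrib[of s \<eta> T, symmetric] using \<eta> by simp_all
        have "f T (s * T) * (\<eta> * T) \<le> loc_cdf T' (s * T) - loc_cdf T' (s * T - \<eta> * T)"
        proof (rule density_le_average[OF f[OF T] t H])
          show "\<eta> * T \<le> T - T'" by (simp add: T'_def algebra_simps)
          show "\<eta> * T \<le> s * T" using s \<eta> T by (intro mult_right_mono) auto
          show "s * T \<le> T'" unfolding T'_def using s \<eta> T by (intro mult_right_mono) auto
        qed
        also have "\<dots> \<le> x - y + 2 * \<delta>"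
          using elim(1)[folded T'_def, rule_format, OF x(1)] elim(1)[folded T'_def, rule_format, OF x(2)]
          unfolding eq by linarith
        also have "x - y = \<eta> / (1 - \<eta>)" by (simp add: x_def y_def diff_divide_distrib)
        also have "\<eta> / (1 - \<eta>) + 2 * \<delta> = \<eta> * (1 / (1 - \<eta>) + e / 2)" by (simp add: \<delta>_def algebra_simps)
        finally have "\<eta> * (T * f T (s * T)) \<le> \<eta> * (1 / (1 - \<eta>) + e / 2)" by (simp add: mult_ac)
        then have "T * f T (s * T) \<le> 1 / (1 - \<eta>) + e / 2" using \<eta> by simp
        moreover have "1 / (1 - \<eta>) \<le> 1 + e / 2"
          using \<eta> e by (simp add: field_simps)
        ultimately show ?thesis by simp
      qed
      have lower: "1 - e \<le> T * f T (s * T)"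
      proof -
        define T' where "T' = (1 + \<eta>) * T"
        define x where "x = s / (1 + \<eta>)"
        define y where "y = (s + \<eta>) / (1 + \<eta>)"
        have x: "x \<in> {0..1}" "y \<in> {0..1}" using s \<eta> s01 by (auto simp: x_def y_def)
        have eq: "x * T' = s * T" "y * T' = s * T + \<eta> * T"
          unfolding x_def y_def T'_def distrib_right[of s \<eta> T, symmetric] using \<eta> by simp_all
        have "\<eta> * (1 / (1 + \<eta>) - e / 2) = \<eta> / (1 + \<eta>) - 2 * \<delta>" by (simp add: \<delta>_def algebra_simps)
        also have "\<eta> / (1 + \<eta>) = y - x" by (simp add: x_def y_def add_divide_distrib)
        also have "y - x - 2 * \<delta> \<le> loc_cdf T' (s * T + \<eta> * T) - loc_cdf T' (s * T)"
          using elim(2)[folded T'_def, rule_format, OF x(1)] elim(2)[folded T'_def, rule_format, OF x(2)]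
          unfolding eq by linarith
        also have "\<dots> \<le> f T (s * T) * (\<eta> * T)"
          by (rule density_ge_average[OF f[OF T] t H]) (simp add: T'_def algebra_simps)
        finally have "\<eta> * (1 / (1 + \<eta>) - e / 2) \<le> \<eta> * (T * f T (s * T))" by (simp add: mult_ac)
        then have "1 / (1 + \<eta>) - e / 2 \<le> T * f T (s * T)" using \<eta> by simp
        moreover have "1 - \<eta> \<le> 1 / (1 + \<eta>)" using \<eta> by (simp add: field_simps)
        ultimately show ?thesis using \<eta>(4) by simp
      qed
      show "\<bar>T * f T (s * T) - 1\<bar> \<le> e" using upper lower by simp
    qed
  qed
qed

lemma density_convergence:
  assumes tail: "TailSM M X" and A: "assumption_A M X"
    and f: "\<And>T. 0 < T \<Longrightarrow> sup_loc_density M X T (f T)"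
    and \<epsilon>: "0 < \<epsilon>" "\<epsilon> < 1/2"
  shows "((\<lambda>T. SUP t\<in>{\<epsilon>..1-\<epsilon>}. \<bar>T * f T (t * T) - 1\<bar>) \<longlongrightarrow> 0) at_top"
proof (rule tendstoI)
  fix e :: real assume "0 < e"
  then have "\<forall>\<^sub>F T in at_top. \<forall>t\<in>{\<epsilon>..1-\<epsilon>}. \<bar>T * f T (t * T) - 1\<bar> \<le> e / 2"
    using density_uniform[OF tail A f \<epsilon>(1), of "e / 2"] by simp
  then show "\<forall>\<^sub>F T in at_top. dist (SUP t\<in>{\<epsilon>..1-\<epsilon>}. \<bar>T * f T (t * T) - 1\<bar>) 0 < e"
  proof eventually_elim
    case (elim T)
    let ?S = "SUP t\<in>{\<epsilon>..1-\<epsilon>}. \<bar>T * f T (t * T) - 1\<bar>"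
    have "?S \<le> e / 2" using elim \<epsilon> by (intro cSUP_least) auto
    \<comment> \<open>Comparison with one term shows that the supremum is nonnegative; the uniform
      bound guarantees that it is a genuine supremum.\<close>
    moreover have "\<bar>T * f T (\<epsilon> * T) - 1\<bar> \<le> ?S"
      using elim \<epsilon> by (intro cSUP_upper bdd_aboveI2[of _ _ "e / 2"]) auto
    ultimately show ?case using \<open>0 < e\<close> by simp
  qed
qed

text \<open>Uniform closeness on \<open>[0, 1]\<close> settles the distribution functions there, and
  outside \<open>[0, 1]\<close> they agree exactly with the limit as soon as the horizon is
  positive.\<close>

lemma location_weak_convergence:
  assumes tail: "TailSM M X" and A: "assumption_A M X" and Ts: "filterlim Ts at_top sequentially"
  shows "weak_conv_m (\<lambda>n. distr M borel (\<lambda>\<omega>. sup_loc X (Ts n) \<omega> / Ts n)) (uniform_measure lborel {0<..<1})"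
  unfolding weak_conv_m_def weak_conv_def cdf_uniform_measure_unit
proof (intro allI impI)
  fix x :: real
  have "((\<lambda>T. loc_cdf T (x * T)) \<longlongrightarrow> max 0 (min 1 x)) at_top"
  proof (rule tendstoI)
    fix e :: real assume "0 < e"
    then have "0 < e / 2" by simp
    from loc_cdf_uniform[OF tail A this] eventually_gt_at_top[of 0]
    show "\<forall>\<^sub>F T in at_top. dist (loc_cdf T (x * T)) (max 0 (min 1 x)) < e"
    proof eventually_elim
      case (elim T)
      consider "x < 0" | "0 \<le> x" "x \<le> 1" | "1 < x" by linarith
      then show ?case
      proof cases
        case 1
        then have "loc_cdf T (x * T) = 0" using elim by (intro loc_cdf_neg) (auto simp: mult_neg_pos)
        then show ?thesis using 1 \<open>0 < e\<close> by simp
      next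
        case 2
        then have "\<bar>loc_cdf T (x * T) - x\<bar> \<le> e / 2" using elim(1) by simp
        then show ?thesis using 2 \<open>0 < e\<close> by (simp add: dist_real_def)
      next
        case 3
        then have "loc_cdf T (x * T) = 1" using elim by (intro loc_cdf_ge) auto
        then show ?thesis using 3 \<open>0 < e\<close> by simp
      qed
    qed
  qed
  then have "(\<lambda>n. loc_cdf (Ts n) (x * Ts n)) \<longlonglongrightarrow> max 0 (min 1 x)" using Ts by (rule filterlim_compose)
  moreover have "\<forall>\<^sub>F n in sequentially. loc_cdf (Ts n) (x * Ts n) =
      cdf (distr M borel (\<lambda>\<omega>. sup_loc X (Ts n) \<omega> / Ts n)) x"
    using filterlim_at_top_dense[THEN iffD1, OF Ts, rule_format, of 0]
  proof eventually_elim
    case (elim n)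
    note [measurable] = sup_loc_measurable[OF less_imp_le[OF elim]]
    have "cdf (distr M borel (\<lambda>\<omega>. sup_loc X (Ts n) \<omega> / Ts n)) x =
        prob ((\<lambda>\<omega>. sup_loc X (Ts n) \<omega> / Ts n) -` {..x} \<inter> space M)"
      by (simp add: cdf_def measure_distr)
    also have "(\<lambda>\<omega>. sup_loc X (Ts n) \<omega> / Ts n) -` {..x} \<inter> space M = {\<omega> \<in> space M. sup_loc X (Ts n) \<omega> \<le> x * Ts n}"
      using elim by (auto simp: pos_divide_le_eq)
    finally show ?case by (simp add: loc_cdf_def)
  qed
  ultimately show "(\<lambda>n. cdf (distr M borel (\<lambda>\<omega>. sup_loc X (Ts n) \<omega> / Ts n)) x) \<longlonglongrightarrow> max 0 (min 1 x)"
    by (rule Lim_transform_eventually)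
qed

end

theorem theorem4p1:
  fixes M :: "'a measure" and X :: "real \<Rightarrow> 'a \<Rightarrow> real"
  assumes "prob_space M"
    and "\<And>t. X t \<in> borel_measurable M"
    and "stationary M X"
    and "\<And>\<omega>. \<omega> \<in> space M \<Longrightarrow> upper_semicontinuous (\<lambda>t. X t \<omega>)"
    and "separable_process M X"
    and "TailSM M X"
    and "assumption_A M X"
  shows "(\<forall>f :: real \<Rightarrow> real \<Rightarrow> real. (\<forall>T>0. sup_loc_density M X T (f T)) \<longrightarrow>
            (\<forall>\<epsilon>. 0 < \<epsilon> \<and> \<epsilon> < 1/2 \<longrightarrow>
               ((\<lambda>T. SUP t\<in>{\<epsilon>..1-\<epsilon>}. \<bar>T * f T (t * T) - 1\<bar>) \<longlongrightarrow> 0) at_top)) \<and>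
         (\<forall>Ts :: nat \<Rightarrow> real. filterlim Ts at_top sequentially \<longrightarrow>
            weak_conv_m (\<lambda>n. distr M borel (\<lambda>\<omega>. sup_loc X (Ts n) \<omega> / Ts n))
                        (uniform_measure lborel {0<..<1}))"
proof -
  interpret usc_process M X
    using assms by (simp add: usc_process_def usc_process_axioms_def)
  show ?thesis
    using density_convergence[OF assms(6,7)] location_weak_convergence[OF assms(6,7)] by blast
qed

end
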